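(* Let $n\ge 1$ and let $G$ be a finite nontrivial subgroup of $SL_n(\mathbb{C})$, with natural representation $\pi$ on $\mathbb{C}^n$ and with $\rho_0,\dots,\rho_s$ the complete list of inequivalent irreducible complex representations of $G$, with characters $\gamma_0,\dots,\gamma_s$. Let $A=B+B^{t}$ be the generalized Cartan matrix of $G$ associated with $\pi$. Then $A$ is positive semi-definite, and the dimension vector $\delta=(\dim\gamma_0,\dots,\dim\gamma_s)^{t}$ is an eigenvector of $A$ with eigenvalue $0$.
   Context: The natural representation $\pi$ is the representation of $G$ on $\mathbb{C}^n$ given by the inclusion $G\subset SL_n(\mathbb{C})$. The non-negative integers $m_{ij}$ ($0\le i,j\le s$) are defined by the decomposition $\pi\otimes\rho_i\cong\bigoplus_j m_{ij}\rho_j$, i.e. $m_{ij}$ is the multiplicity of $\rho_j$ in $\pi\otimes\rho_i$. The pre-Cartan matrix is $B=(b_{ij})$ with $b_{ij}=n\delta_{ij}-m_{ij}$ (where $\delta_{ij}$ is the Kronecker delta). The generalized Cartan matrix of $G$ associated with $\pi$ is $A=B+B^{t}$, where $B^t$ is the transpose of $B$. Here $\dim\gamma_i=\gamma_i(1)$ is the dimension of $\rho_i$. *)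

theory Defs
  imports "Jordan_Normal_Form.VS_Connect" "Jordan_Normal_Form.Char_Poly"
begin

text \<open>
  Matrices are those of \<open>Jordan_Normal_Form\<close>, whose dimension is part of the value; this allows
  the degree of a representation to be an arbitrary natural number.
\<close>

definition GL :: "nat \<Rightarrow> complex mat monoid" where
  "GL d = units_of (ring_mat TYPE(complex) d ())"

definition SL :: "nat \<Rightarrow> complex mat monoid" where
  "SL n = (GL n)\<lparr>carrier := {A \<in> carrier_mat n n. det A = 1}\<rparr>"

lemma carrier_GL: "carrier (GL d) = {A \<in> carrier_mat d d. \<exists>B \<in> carrier_mat d d. B * A = 1\<^sub>m d \<and> A * B = 1\<^sub>m d}"
  by (auto simp: GL_def units_of_def Units_def ring_mat_simps)

lemma mult_GL [simp]: "x \<otimes>\<^bsub>GL d\<^esub> y = x * y"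
  by (simp add: GL_def units_of_def ring_mat_simps)

lemma one_GL [simp]: "\<one>\<^bsub>GL d\<^esub> = 1\<^sub>m d"
  by (simp add: GL_def units_of_def ring_mat_simps)

lemma carrier_SL: "carrier (SL n) = {A \<in> carrier_mat n n. det A = 1}"
  by (simp add: SL_def)

lemma mult_SL [simp]: "x \<otimes>\<^bsub>SL n\<^esub> y = x * y"
  using mult_GL by (simp add: SL_def)

lemma one_SL [simp]: "\<one>\<^bsub>SL n\<^esub> = 1\<^sub>m n"
  using one_GL by (simp add: SL_def)

lemma group_GL: "group (GL d)"
proof -
  interpret ring "ring_mat TYPE(complex) d ()" by (rule ring_mat)
  show ?thesis unfolding GL_def by (rule units_group)
qed

lemma SL_in_GL:
  assumes "A \<in> carrier (SL n)"
  shows "A \<in> carrier (GL n)"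
  using assms det_non_zero_imp_unit[of A n "()"]
  by (simp add: GL_def units_of_def carrier_SL)

lemma group_SL: "group (SL n)"
proof (rule groupI)
  fix x assume x: "x \<in> carrier (SL n)"
  then obtain y where y: "y \<in> carrier_mat n n" "y * x = 1\<^sub>m n"
    using SL_in_GL[OF x] by (auto simp: carrier_GL)
  moreover have "det y = 1"
    using y x det_mult[of y n x] by (auto simp: carrier_SL)
  ultimately show "\<exists>y\<in>carrier (SL n). y \<otimes>\<^bsub>SL n\<^esub> x = \<one>\<^bsub>SL n\<^esub>"
    by (auto simp: carrier_SL)
qed (auto simp: carrier_SL det_mult)

text \<open>
  A (finite-dimensional complex) representation of a group \<open>G\<close> is given in matrix form, as a
  homomorphism from \<open>G\<close> to \<open>GL d\<close>. The degree \<open>d\<close> is not a separate parameter: it is read off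
  from the matrix of the neutral element.
\<close>

definition rep_dim :: "('g, 'b) monoid_scheme \<Rightarrow> ('g \<Rightarrow> complex mat) \<Rightarrow> nat" where
  "rep_dim G \<rho> = dim_row (\<rho> \<one>\<^bsub>G\<^esub>)"

definition representation :: "('g, 'b) monoid_scheme \<Rightarrow> ('g \<Rightarrow> complex mat) \<Rightarrow> bool" where
  "representation G \<rho> \<longleftrightarrow> \<rho> \<in> hom G (GL (rep_dim G \<rho>))"

definition rep_iso :: "('g, 'b) monoid_scheme \<Rightarrow> ('g \<Rightarrow> complex mat) \<Rightarrow> ('g \<Rightarrow> complex mat) \<Rightarrow> bool" where
  "rep_iso G \<sigma> \<tau> \<longleftrightarrow> rep_dim G \<sigma> = rep_dim G \<tau> \<and>
     (\<exists>P \<in> carrier (GL (rep_dim G \<sigma>)). \<forall>g \<in> carrier G. P * \<sigma> g = \<tau> g * P)"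

definition irreducible_rep :: "('g, 'b) monoid_scheme \<Rightarrow> ('g \<Rightarrow> complex mat) \<Rightarrow> bool" where
  "irreducible_rep G \<rho> \<longleftrightarrow> representation G \<rho> \<and> rep_dim G \<rho> > 0 \<and>
     (\<forall>W. VectorSpace.subspace class_ring W (module_vec TYPE(complex) (rep_dim G \<rho>)) \<and>
          (\<forall>g \<in> carrier G. \<forall>w \<in> W. \<rho> g *\<^sub>v w \<in> W) \<longrightarrow>
          W = {0\<^sub>v (rep_dim G \<rho>)} \<or> W = carrier_vec (rep_dim G \<rho>))"

definition complete_irreps :: "('g, 'b) monoid_scheme \<Rightarrow> nat \<Rightarrow> (nat \<Rightarrow> 'g \<Rightarrow> complex mat) \<Rightarrow> bool" where
  "complete_irreps G s \<rho> \<longleftrightarrow>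
     (\<forall>i \<le> s. irreducible_rep G (\<rho> i)) \<and>
     (\<forall>i \<le> s. \<forall>j \<le> s. i \<noteq> j \<longrightarrow> \<not> rep_iso G (\<rho> i) (\<rho> j)) \<and>
     (\<forall>\<sigma>. irreducible_rep G \<sigma> \<longrightarrow> (\<exists>i \<le> s. rep_iso G \<sigma> (\<rho> i)))"

definition kronecker :: "complex mat \<Rightarrow> complex mat \<Rightarrow> complex mat" where
  "kronecker A B = mat (dim_row A * dim_row B) (dim_col A * dim_col B)
     (\<lambda>(i, j). A $$ (i div dim_row B, j div dim_col B) * B $$ (i mod dim_row B, j mod dim_col B))"

definition tensor_rep :: "('g \<Rightarrow> complex mat) \<Rightarrow> ('g \<Rightarrow> complex mat) \<Rightarrow> 'g \<Rightarrow> complex mat" where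
  "tensor_rep \<sigma> \<tau> g = kronecker (\<sigma> g) (\<tau> g)"

text \<open>The direct sum of \<open>m j\<close> copies of \<open>\<rho> j\<close>, for \<open>j = 0, \<dots>, s\<close>.\<close>

definition sum_rep :: "nat \<Rightarrow> (nat \<Rightarrow> nat) \<Rightarrow> (nat \<Rightarrow> 'g \<Rightarrow> complex mat) \<Rightarrow> 'g \<Rightarrow> complex mat" where
  "sum_rep s m \<rho> g = diag_block_mat (concat (map (\<lambda>j. replicate (m j) (\<rho> j g)) [0..<Suc s]))"

text \<open>
  Only the values \<open>m 0, \<dots>, m s\<close> matter in a decomposition, so the family \<open>m\<close> as a
  function on all naturals is not unique; the definite description is for the single value \<open>m j\<close>.
\<close>

definition multiplicity_in ::
  "('g, 'b) monoid_scheme \<Rightarrow> nat \<Rightarrow> (nat \<Rightarrow> 'g \<Rightarrow> complex mat) \<Rightarrow> nat \<Rightarrow> ('g \<Rightarrow> complex mat) \<Rightarrow> nat" where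
  "multiplicity_in G s \<rho> j \<tau> = (THE k. \<exists>m. rep_iso G \<tau> (sum_rep s m \<rho>) \<and> m j = k)"

definition pre_Cartan ::
  "('g, 'b) monoid_scheme \<Rightarrow> ('g \<Rightarrow> complex mat) \<Rightarrow> nat \<Rightarrow> (nat \<Rightarrow> 'g \<Rightarrow> complex mat) \<Rightarrow> real mat" where
  "pre_Cartan G \<pi> s \<rho> = mat (Suc s) (Suc s)
     (\<lambda>(i, j). (if i = j then real (rep_dim G \<pi>) else 0)
               - real (multiplicity_in G s \<rho> j (tensor_rep \<pi> (\<rho> i))))"

definition generalized_Cartan ::
  "('g, 'b) monoid_scheme \<Rightarrow> ('g \<Rightarrow> complex mat) \<Rightarrow> nat \<Rightarrow> (nat \<Rightarrow> 'g \<Rightarrow> complex mat) \<Rightarrow> real mat" where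
  "generalized_Cartan G \<pi> s \<rho> = pre_Cartan G \<pi> s \<rho> + transpose_mat (pre_Cartan G \<pi> s \<rho>)"

definition pos_semidef :: "real mat \<Rightarrow> bool" where
  "pos_semidef A \<longleftrightarrow> square_mat A \<and> transpose_mat A = A \<and>
     (\<forall>x \<in> carrier_vec (dim_row A). x \<bullet> (A *\<^sub>v x) \<ge> 0)"

definition character :: "('g \<Rightarrow> complex mat) \<Rightarrow> 'g \<Rightarrow> complex" where
  "character \<rho> g = (\<Sum>i < dim_row (\<rho> g). \<rho> g $$ (i, i))"

text \<open>The dimension of \<open>\<gamma>\<close> is \<open>\<gamma> 1\<close>, which is the dimension of the underlying space.\<close>

lemma character_one:
  assumes "group G" "representation G \<rho>"
  shows "character \<rho> \<one>\<^bsub>G\<^esub> = of_nat (rep_dim G \<rho>)"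
proof -
  have "\<rho> \<one>\<^bsub>G\<^esub> = 1\<^sub>m (rep_dim G \<rho>)"
    using hom_one[of \<rho> G "GL (rep_dim G \<rho>)"] assms group_GL
    by (simp add: representation_def)
  then show ?thesis by (simp add: character_def)
qed

definition dim_vector ::
  "('g, 'b) monoid_scheme \<Rightarrow> nat \<Rightarrow> (nat \<Rightarrow> 'g \<Rightarrow> complex mat) \<Rightarrow> real vec" where
  "dim_vector G s \<rho> = vec (Suc s) (\<lambda>i. real (rep_dim G (\<rho> i)))"

definition subgroup_of_SL :: "nat \<Rightarrow> complex mat set \<Rightarrow> complex mat monoid" where
  "subgroup_of_SL n G = (SL n)\<lparr>carrier := G\<rparr>"

definition natural_rep :: "complex mat \<Rightarrow> complex mat" where
  "natural_rep g = g"

lemma representation_natural_rep: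
  assumes "subgroup G (SL n)"
  shows "representation (subgroup_of_SL n G) natural_rep"
    and "rep_dim (subgroup_of_SL n G) natural_rep = n"
proof -
  show d: "rep_dim (subgroup_of_SL n G) natural_rep = n"
    by (simp add: rep_dim_def subgroup_of_SL_def natural_rep_def)
  show "representation (subgroup_of_SL n G) natural_rep"
    unfolding representation_def d
    using subgroup.subset[OF assms] SL_in_GL
    by (auto simp: hom_def subgroup_of_SL_def natural_rep_def)
qed

end

theory Submission
  imports Defs "Jordan_Normal_Form.Spectral_Radius"
begin

text \<open>
  Write \<open>m\<^sub>i\<^sub>j\<close> for the multiplicity of \<open>\<rho>\<^sub>j\<close> in \<open>\<pi> \<otimes> \<rho>\<^sub>i\<close> and \<open>d\<^sub>i\<close> for the dimension of \<open>\<rho>\<^sub>i\<close>.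
  Everything follows from the fact that the positive vector \<open>d\<close> is an eigenvector, with eigenvalue \<open>n\<close>, of
  both \<open>(m\<^sub>i\<^sub>j)\<close> and its transpose. Counting dimensions in \<open>\<pi> \<otimes> \<rho>\<^sub>i\<close> gives \<open>\<Sum>\<^sub>j m\<^sub>i\<^sub>j d\<^sub>j = n d\<^sub>i\<close>.
  For the transpose, \<open>m\<^sub>i\<^sub>j\<close> is also the multiplicity of \<open>\<rho>\<^sub>i\<close> in \<open>\<pi>\<^sup>* \<otimes> \<rho>\<^sub>j\<close>, where \<open>\<pi>\<^sup>*\<close> is the dual of
  \<open>\<pi>\<close> (lemma \<open>multiplicity_dual\<close>), and the same count for \<open>\<pi>\<^sup>*\<close> gives \<open>\<Sum>\<^sub>i m\<^sub>i\<^sub>j d\<^sub>i = n d\<^sub>j\<close>.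
  Together the two relations say that \<open>A d = 0\<close>. They also make \<open>A\<close> a weighted graph Laplacian in the rescaled
  coordinates \<open>x\<^sub>i / d\<^sub>i\<close>: by \<open>weighted_laplacian_identity\<close>,
  \<open>x\<^sup>t A x = \<Sum>\<^sub>i\<^sub>j m\<^sub>i\<^sub>j d\<^sub>i d\<^sub>j (x\<^sub>i / d\<^sub>i - x\<^sub>j / d\<^sub>j)\<^sup>2 \<ge> 0\<close>.

  The multiplicities are given by a definite description, so the argument needs the existence and the uniqueness
  of the decomposition into irreducible representations. Existence is Maschke's theorem: a proper invariant
  subspace makes the representation block triangular in an adapted basis (\<open>adapted_basis\<close>), and averaging over
  the group removes the block above the diagonal (\<open>block_triangular_splits\<close>). Uniqueness follows from the
  orthogonality of irreducible characters, which comes from Schur's lemma applied to averages of matrix units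
  (\<open>char_pairing_average\<close>). Orthogonality moreover expresses each multiplicity as a pairing of characters
  (\<open>char_pairing_multiplicity\<close>), and in this form the duality above is the substitution \<open>g \<mapsto> g\<^sup>-\<^sup>1\<close>.
\<close>

section \<open>Matrices and subspaces\<close>

definition trace_mat :: "'a :: comm_ring_1 mat \<Rightarrow> 'a" where
  "trace_mat A = (\<Sum>i<dim_row A. A $$ (i, i))"

lemma trace_mat_mult_comm:
  assumes "A \<in> carrier_mat n m" "B \<in> carrier_mat m n"
  shows "trace_mat (A * B) = trace_mat (B * A)"
proof -
  have "trace_mat (A * B) = (\<Sum>i<n. \<Sum>j<m. A $$ (i, j) * B $$ (j, i))"
    using assms by (auto simp: trace_mat_def scalar_prod_def lessThan_atLeast0 intro!: sum.cong)
  also have "\<dots> = (\<Sum>j<m. \<Sum>i<n. B $$ (j, i) * A $$ (i, j))"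
    by (subst sum.swap) (simp add: mult.commute)
  also have "\<dots> = trace_mat (B * A)"
    using assms by (auto simp: trace_mat_def scalar_prod_def lessThan_atLeast0 intro!: sum.cong)
  finally show ?thesis .
qed

lemma trace_mat_one [simp]: "trace_mat (1\<^sub>m n) = of_nat n"
  by (simp add: trace_mat_def)

lemma trace_mat_four_block:
  assumes "A \<in> carrier_mat n n" "D \<in> carrier_mat m m"
  shows "trace_mat (four_block_mat A B C D) = trace_mat A + trace_mat D"
proof -
  have "trace_mat (four_block_mat A B C D) = (\<Sum>i<n+m. four_block_mat A B C D $$ (i, i))"
    using assms by (simp add: trace_mat_def)
  also have "\<dots> = (\<Sum>i\<in>{..<n}. four_block_mat A B C D $$ (i, i))
      + (\<Sum>i\<in>{n..<n+m}. four_block_mat A B C D $$ (i, i))"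
    by (simp only: lessThan_atLeast0 sum.atLeastLessThan_concat le0 le_add1)
  also have "(\<Sum>i\<in>{n..<n+m}. four_block_mat A B C D $$ (i, i))
      = (\<Sum>i<m. four_block_mat A B C D $$ (i + n, i + n))"
    using sum.shift_bounds_nat_ivl[of "\<lambda>i. four_block_mat A B C D $$ (i, i)" 0 n m]
    by (simp add: lessThan_atLeast0 add.commute)
  also have "(\<Sum>i<m. four_block_mat A B C D $$ (i + n, i + n)) = trace_mat D"
    using assms by (auto simp: trace_mat_def intro!: sum.cong)
  also have "(\<Sum>i<n. four_block_mat A B C D $$ (i, i)) = trace_mat A"
    using assms by (auto simp: trace_mat_def intro!: sum.cong)
  finally show ?thesis .
qed

lemma mult_mat_unit_vec:
  fixes A :: "'a :: semiring_1 mat"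
  assumes "A \<in> carrier_mat nr nc" "j < nc"
  shows "A *\<^sub>v unit_vec nc j = col A j"
  using assms by (intro eq_vecI) auto

text \<open>
  Preimages of the unit vectors are the columns of a right inverse \<open>S\<close>, and injectivity makes it a left
  inverse too. In characteristic zero the two dimensions then agree because they are the traces of \<open>T * S\<close> and
  \<open>S * T\<close>.
\<close>
lemma bijective_mat_inverse:
  fixes T :: "complex mat"
  assumes T: "T \<in> carrier_mat e d"
    and inj: "\<And>v. v \<in> carrier_vec d \<Longrightarrow> T *\<^sub>v v = 0\<^sub>v e \<Longrightarrow> v = 0\<^sub>v d"
    and surj: "\<And>w. w \<in> carrier_vec e \<Longrightarrow> \<exists>v\<in>carrier_vec d. T *\<^sub>v v = w"
  shows "d = e" "\<exists>S\<in>carrier_mat d d. T * S = 1\<^sub>m d \<and> S * T = 1\<^sub>m d"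
proof -
  obtain f where f: "\<And>w. w \<in> carrier_vec e \<Longrightarrow> f w \<in> carrier_vec d \<and> T *\<^sub>v f w = w"
    using surj by metis
  define S where "S = mat_of_cols d (map (\<lambda>j. f (unit_vec e j)) [0..<e])"
  have S: "S \<in> carrier_mat d e" by (rule carrier_matI) (auto simp: S_def)
  have colS: "col S j = f (unit_vec e j)" if "j < e" for j
    using that f[of "unit_vec e j"] by (simp add: S_def col_mat_of_cols)
  have TS: "T * S = 1\<^sub>m e"
  proof (rule mat_col_eqI)
    fix j assume j: "j < dim_col (1\<^sub>m e :: complex mat)"
    then show "col (T * S) j = col (1\<^sub>m e) j"
      using col_mult2[OF T S, of j] colS[of j] f[of "unit_vec e j"] by simp
  qed (use T S in auto)
  have ST: "S * T = 1\<^sub>m d"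
  proof (rule mat_col_eqI)
    fix j assume "j < dim_col (1\<^sub>m d :: complex mat)"
    then have j: "j < d" by simp
    let ?u = "unit_vec d j :: complex vec"
    have u: "?u \<in> carrier_vec d" by simp
    have Tu: "T *\<^sub>v ?u \<in> carrier_vec e" using T by auto
    have STu: "S *\<^sub>v (T *\<^sub>v ?u) \<in> carrier_vec d" using S Tu by auto
    have "T *\<^sub>v (S *\<^sub>v (T *\<^sub>v ?u)) = (T * S) *\<^sub>v (T *\<^sub>v ?u)"
      using T S Tu by (simp add: assoc_mult_mat_vec)
    also have "\<dots> = T *\<^sub>v ?u" using Tu by (simp add: TS)
    finally have "T *\<^sub>v (S *\<^sub>v (T *\<^sub>v ?u) - ?u) = 0\<^sub>v e"
      using mult_minus_distrib_mat_vec[OF T STu u] Tu by simp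
    then have "S *\<^sub>v (T *\<^sub>v ?u) - ?u = 0\<^sub>v d"
      using inj STu by auto
    then have "S *\<^sub>v (T *\<^sub>v ?u) = ?u"
      using STu S by (auto simp: vec_eq_iff)
    moreover have "col (S * T) j = S *\<^sub>v (T *\<^sub>v ?u)"
      using j S T col_mult2[OF S T j] mult_mat_unit_vec[OF T j] by simp
    ultimately show "col (S * T) j = col (1\<^sub>m d) j" using j by simp
  qed (use T S in auto)
  have "(of_nat e :: complex) = of_nat d"
    using trace_mat_mult_comm[OF T S] TS ST by simp
  then show "d = e" by simp
  then show "\<exists>S\<in>carrier_mat d d. T * S = 1\<^sub>m d \<and> S * T = 1\<^sub>m d"
    using S TS ST by auto
qed

text \<open>
  With more columns than rows, filling up with zero rows yields a singular square matrix with the same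
  kernel.
\<close>
lemma injective_mat_dim_le:
  fixes J :: "complex mat"
  assumes J: "J \<in> carrier_mat d r"
    and inj: "\<And>v. v \<in> carrier_vec r \<Longrightarrow> J *\<^sub>v v = 0\<^sub>v d \<Longrightarrow> v = 0\<^sub>v r"
  shows "r \<le> d"
proof (rule ccontr)
  assume "\<not> r \<le> d"
  then have dr: "d < r" by simp
  define A where "A = mat r r (\<lambda>(i, j). if i < d then J $$ (i, j) else 0)"
  have A: "A \<in> carrier_mat r r" by (simp add: A_def)
  have "A *\<^sub>v v = 0\<^sub>v r \<Longrightarrow> v = 0\<^sub>v r" if v: "v \<in> carrier_vec r" for v
  proof (rule inj[OF v])
    assume z: "A *\<^sub>v v = 0\<^sub>v r"
    show "J *\<^sub>v v = 0\<^sub>v d"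
    proof (rule eq_vecI)
      fix i assume "i < dim_vec (0\<^sub>v d :: complex vec)"
      then have i: "i < d" by simp
      then have "(A *\<^sub>v v) $ i = 0" using z dr by simp
      moreover have "row A i = row J i" using i dr J by (auto simp: A_def)
      ultimately show "(J *\<^sub>v v) $ i = 0\<^sub>v d $ i" using i dr A J by simp
    qed (use J in auto)
  qed
  then have "det A \<noteq> 0" using det_0_iff_vec_prod_zero[OF A] by blast
  moreover have "det A = 0"
  proof -
    have "transpose_mat A *\<^sub>v unit_vec r d = 0\<^sub>v r"
      using dr by (auto simp: A_def scalar_prod_def intro!: eq_vecI sum.neutral)
    moreover have "unit_vec r d \<noteq> (0\<^sub>v r :: complex vec)" using dr
      by (metis index_unit_vec(1) index_zero_vec(1) zero_neq_one)
    ultimately have "det (transpose_mat A) = 0"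
      using det_0_iff_vec_prod_zero[of "transpose_mat A" r] A by (auto intro!: exI[of _ "unit_vec r d"])
    then show ?thesis using det_transpose[OF A] by simp
  qed
  ultimately show False by simp
qed

text \<open>
  Subspaces of \<open>\<complex>\<^sup>d\<close>, spelled out with the operations on vectors instead of those of the module record.
\<close>
definition vec_closed :: "nat \<Rightarrow> complex vec set \<Rightarrow> bool" where
  "vec_closed d W \<longleftrightarrow> W \<subseteq> carrier_vec d \<and> 0\<^sub>v d \<in> W \<and> (\<forall>v\<in>W. \<forall>w\<in>W. v + w \<in> W) \<and> (\<forall>c. \<forall>v\<in>W. c \<cdot>\<^sub>v v \<in> W)"

lemma subspace_iff_vec_closed:
  "VectorSpace.subspace class_ring W (module_vec TYPE(complex) d) \<longleftrightarrow> vec_closed d W"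
proof
  assume "VectorSpace.subspace class_ring W (module_vec TYPE(complex) d)"
  then interpret submodule class_ring W "module_vec TYPE(complex) d"
    by (rule subspace.submod)
  show "vec_closed d W"
    using subset m_closed zero_closed smult_closed
    by (auto simp: vec_closed_def module_vec_simps)
next
  assume "vec_closed d W"
  then show "VectorSpace.subspace class_ring W (module_vec TYPE(complex) d)"
    unfolding VectorSpace.subspace_def LinearCombinations.submodule_def
    by (auto simp: vec_closed_def module_vec_simps vec_vs vec_module)
qed

text \<open>
  The columns of an injective matrix form a linearly independent list, so this is the extension of such a
  list to a basis of \<open>W\<close>: as long as the columns do not span \<open>W\<close>, a vector of \<open>W\<close> outside their span can be
  appended, and the number of columns cannot exceed \<open>d\<close>.
\<close>
lemma extend_to_spanning_columns:
  fixes J0 :: "complex mat"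
  assumes W: "vec_closed d W"
    and J0: "J0 \<in> carrier_mat d r0"
    and inj: "\<And>v. v \<in> carrier_vec r0 \<Longrightarrow> J0 *\<^sub>v v = 0\<^sub>v d \<Longrightarrow> v = 0\<^sub>v r0"
    and into: "\<And>v. v \<in> carrier_vec r0 \<Longrightarrow> J0 *\<^sub>v v \<in> W"
  shows "\<exists>r J. r0 \<le> r \<and> J \<in> carrier_mat d r \<and>
     (\<forall>v \<in> carrier_vec r. J *\<^sub>v v = 0\<^sub>v d \<longrightarrow> v = 0\<^sub>v r) \<and>
     (\<lambda>v. J *\<^sub>v v) ` carrier_vec r = W \<and> (\<forall>j<r0. col J j = col J0 j)"
  using J0 inj into
proof (induction "d - r0" arbitrary: r0 J0 rule: less_induct)
  case less
  note J0 = less.prems(1)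
  show ?case
  proof (cases "(\<lambda>v. J0 *\<^sub>v v) ` carrier_vec r0 = W")
    case True
    then show ?thesis using less.prems by (intro exI[of _ r0] exI[of _ J0]) auto
  next
    case False
    then obtain w where w: "w \<in> W" "\<And>v. v \<in> carrier_vec r0 \<Longrightarrow> J0 *\<^sub>v v \<noteq> w"
      using less.prems(3) by auto
    have wc: "w \<in> carrier_vec d" using w W by (auto simp: vec_closed_def)
    define J1 where "J1 = mat d (Suc r0) (\<lambda>(i, j). if j < r0 then J0 $$ (i, j) else w $ i)"
    have J1: "J1 \<in> carrier_mat d (Suc r0)" by (simp add: J1_def)
    have mul: "J1 *\<^sub>v v = J0 *\<^sub>v vec_first v r0 + v $ r0 \<cdot>\<^sub>v w" if v: "v \<in> carrier_vec (Suc r0)" for v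
      using v J0 wc
      by (auto simp: J1_def scalar_prod_def vec_first_def intro!: eq_vecI)
    have vf: "vec_first v r0 \<in> carrier_vec r0" for v :: "complex vec" by simp
    have inj1: "v = 0\<^sub>v (Suc r0)" if v: "v \<in> carrier_vec (Suc r0)" and z: "J1 *\<^sub>v v = 0\<^sub>v d" for v
    proof -
      let ?u = "vec_first v r0"
      have eq: "J0 *\<^sub>v ?u + v $ r0 \<cdot>\<^sub>v w = 0\<^sub>v d" using mul[OF v] z by simp
      have c0: "v $ r0 = 0"
      proof (rule ccontr)
        assume c: "v $ r0 \<noteq> 0"
        have "J0 *\<^sub>v ((- 1 / v $ r0) \<cdot>\<^sub>v ?u) = w"
        proof (rule eq_vecI)
          fix i assume i: "i < dim_vec w"
          then have i: "i < d" using wc by simp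
          have "(J0 *\<^sub>v ?u + v $ r0 \<cdot>\<^sub>v w) $ i = 0" using eq i by simp
          then have "(J0 *\<^sub>v ?u) $ i = - (v $ r0 * w $ i)" using i wc J0
            by (simp add: eq_neg_iff_add_eq_0)
          moreover have "J0 *\<^sub>v ((- 1 / v $ r0) \<cdot>\<^sub>v ?u) = (- 1 / v $ r0) \<cdot>\<^sub>v (J0 *\<^sub>v ?u)"
            using mult_mat_vec[OF J0 vf] by simp
          ultimately show "(J0 *\<^sub>v ((- 1 / v $ r0) \<cdot>\<^sub>v ?u)) $ i = w $ i"
            using c i J0 by (simp add: field_simps)
        qed (use J0 wc in auto)
        then show False using w(2)[of "(- 1 / v $ r0) \<cdot>\<^sub>v ?u"] by simp
      qed
      have "v $ r0 \<cdot>\<^sub>v w = 0\<^sub>v d" using c0 wc by (intro eq_vecI) auto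
      then have "J0 *\<^sub>v ?u = 0\<^sub>v d" using eq mult_mat_vec_carrier[OF J0 vf, of v] by simp
      then have "?u = 0\<^sub>v r0" using less.prems(2) vf by blast
      then have "\<forall>i<r0. v $ i = 0"
        by (metis index_vec index_zero_vec(1) vec_first_def)
      then show ?thesis using c0 v by (intro eq_vecI) (auto simp: less_Suc_eq)
    qed
    have into1: "J1 *\<^sub>v v \<in> W" if "v \<in> carrier_vec (Suc r0)" for v
      using mul[OF that] less.prems(3)[OF vf] w(1) W by (auto simp: vec_closed_def)
    have "Suc r0 \<le> d" using injective_mat_dim_le[OF J1] inj1 by blast
    then have "d - Suc r0 < d - r0" by simp
    from less.hyps[OF this J1 inj1 into1] obtain r J where
      rJ: "Suc r0 \<le> r" "J \<in> carrier_mat d r" "\<forall>v \<in> carrier_vec r. J *\<^sub>v v = 0\<^sub>v d \<longrightarrow> v = 0\<^sub>v r"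
       "(\<lambda>v. J *\<^sub>v v) ` carrier_vec r = W" "\<forall>j<Suc r0. col J j = col J1 j" by blast
    have "col J1 j = col J0 j" if "j < r0" for j
      using that J0 by (auto simp: J1_def)
    then show ?thesis using rJ by (intro exI[of _ r] exI[of _ J]) auto
  qed
qed

text \<open>
  A basis of \<open>W\<close> is extended to a basis of the whole space, whose vectors are the columns of \<open>P\<close>. In the
  new coordinates \<open>W\<close> consists of the vectors supported on the first \<open>r\<close> entries.
\<close>
lemma adapted_basis:
  assumes W: "vec_closed d W"
  obtains r P Q where "r \<le> d" "P \<in> carrier_mat d d" "Q \<in> carrier_mat d d"
    "P * Q = 1\<^sub>m d" "Q * P = 1\<^sub>m d"
    "W = (\<lambda>v. P *\<^sub>v v) ` {v \<in> carrier_vec d. \<forall>i. r \<le> i \<longrightarrow> i < d \<longrightarrow> v $ i = 0}"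
proof -
  let ?Z = "0\<^sub>m d 0 :: complex mat"
  have Z: "?Z *\<^sub>v v \<in> W" if "v \<in> carrier_vec 0" for v
  proof -
    have "?Z *\<^sub>v v = 0\<^sub>v d" using that by (intro eq_vecI) (auto simp: scalar_prod_def)
    then show ?thesis using W by (simp add: vec_closed_def)
  qed
  have Zinj: "v = 0\<^sub>v 0" if "v \<in> carrier_vec 0" for v :: "complex vec"
    using that by (intro eq_vecI) auto
  obtain r J where J: "J \<in> carrier_mat d r" "\<forall>v \<in> carrier_vec r. J *\<^sub>v v = 0\<^sub>v d \<longrightarrow> v = 0\<^sub>v r"
       "(\<lambda>v. J *\<^sub>v v) ` carrier_vec r = W"
    using extend_to_spanning_columns[OF W zero_carrier_mat, of 0] Z Zinj by metis
  have full: "vec_closed d (carrier_vec d)" by (auto simp: vec_closed_def)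
  obtain r' P where P: "r \<le> r'" "P \<in> carrier_mat d r'" "\<forall>v \<in> carrier_vec r'. P *\<^sub>v v = 0\<^sub>v d \<longrightarrow> v = 0\<^sub>v r'"
       "(\<lambda>v. P *\<^sub>v v) ` carrier_vec r' = carrier_vec d" "\<forall>j<r. col P j = col J j"
    using extend_to_spanning_columns[OF full J(1)] J by (auto simp: image_iff)
  have inj: "\<And>v. v \<in> carrier_vec r' \<Longrightarrow> P *\<^sub>v v = 0\<^sub>v d \<Longrightarrow> v = 0\<^sub>v r'" using P(3) by blast
  have surj: "\<And>w. w \<in> carrier_vec d \<Longrightarrow> \<exists>v\<in>carrier_vec r'. P *\<^sub>v v = w"
    using P(4) by (metis imageE)
  have r': "r' = d" using bijective_mat_inverse(1)[OF P(2) inj surj] by blast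
  obtain Q where Q: "Q \<in> carrier_mat d d" "P * Q = 1\<^sub>m d" "Q * P = 1\<^sub>m d"
    using bijective_mat_inverse(2)[OF P(2) inj surj] r' by blast
  have ent: "P $$ (i, j) = J $$ (i, j)" if "i < d" "j < r" for i j
  proof -
    have "col P j $ i = col J j $ i" using P(5) that by simp
    then show ?thesis using that P(1,2) J(1) by auto
  qed
  have PJ: "P *\<^sub>v v = J *\<^sub>v vec_first v r"
    if v: "v \<in> carrier_vec d" "\<forall>i. r \<le> i \<longrightarrow> i < d \<longrightarrow> v $ i = 0" for v
  proof (rule eq_vecI)
    fix i assume "i < dim_vec (J *\<^sub>v vec_first v r)"
    then have i: "i < d" using J by simp
    have "(P *\<^sub>v v) $ i = (\<Sum>j\<in>{0..<d}. P $$ (i, j) * v $ j)"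
      using i P(2) v(1) r' by (simp add: scalar_prod_def)
    also have "\<dots> = (\<Sum>j\<in>{0..<r}. P $$ (i, j) * v $ j)"
      using v(2) P(1) r' by (intro sum.mono_neutral_right) auto
    also have "\<dots> = (J *\<^sub>v vec_first v r) $ i"
      using i J(1) ent by (simp add: scalar_prod_def vec_first_def)
    finally show "(P *\<^sub>v v) $ i = (J *\<^sub>v vec_first v r) $ i" .
  qed (use J P in auto)
  have "W = (\<lambda>v. P *\<^sub>v v) ` {v \<in> carrier_vec d. \<forall>i. r \<le> i \<longrightarrow> i < d \<longrightarrow> v $ i = 0}" (is "_ = ?R")
  proof
    show "?R \<subseteq> W" using PJ J(3) by auto
    show "W \<subseteq> ?R"
    proof
      fix w assume "w \<in> W"
      then obtain u where u: "u \<in> carrier_vec r" "w = J *\<^sub>v u" using J(3) by auto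
      define v where "v = vec d (\<lambda>i. if i < r then u $ i else 0)"
      have v: "v \<in> carrier_vec d" "\<forall>i. r \<le> i \<longrightarrow> i < d \<longrightarrow> v $ i = 0" by (auto simp: v_def)
      have "vec_first v r = u" using u P(1) r' by (auto simp: v_def vec_first_def)
      then show "w \<in> ?R" using PJ[OF v] u v by (intro image_eqI[of _ _ v]) auto
    qed
  qed
  then show ?thesis using that[of r P Q] P Q r' by auto
qed

lemma four_block_mat_inject:
  assumes "four_block_mat A B C D = four_block_mat A' B' C' D'"
    and "A \<in> carrier_mat a b" "B \<in> carrier_mat a c" "C \<in> carrier_mat e b" "D \<in> carrier_mat e c"
    and "A' \<in> carrier_mat a b" "B' \<in> carrier_mat a c" "C' \<in> carrier_mat e b" "D' \<in> carrier_mat e c"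
  shows "A = A'" "B = B'" "C = C'" "D = D'"
proof -
  have eq: "four_block_mat A B C D $$ (i, j) = four_block_mat A' B' C' D' $$ (i, j)" for i j
    using assms(1) by simp
  show "A = A'"
  proof (rule eq_matI)
    fix i j assume "i < dim_row A'" "j < dim_col A'"
    then show "A $$ (i, j) = A' $$ (i, j)" using eq[of i j] assms(2-) by auto
  qed (use assms in auto)
  show "B = B'"
  proof (rule eq_matI)
    fix i j assume "i < dim_row B'" "j < dim_col B'"
    then show "B $$ (i, j) = B' $$ (i, j)" using eq[of i "b + j"] assms(2-) by auto
  qed (use assms in auto)
  show "C = C'"
  proof (rule eq_matI)
    fix i j assume "i < dim_row C'" "j < dim_col C'"
    then show "C $$ (i, j) = C' $$ (i, j)" using eq[of "a + i" j] assms(2-) by auto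
  qed (use assms in auto)
  show "D = D'"
  proof (rule eq_matI)
    fix i j assume "i < dim_row D'" "j < dim_col D'"
    then show "D $$ (i, j) = D' $$ (i, j)" using eq[of "a + i" "b + j"] assms(2-) by auto
  qed (use assms in auto)
qed

section \<open>Matrix representations and their isomorphisms\<close>

text \<open>
  The degree is read off from the value at the neutral element; making it a parameter keeps the carrier
  conditions on matrices explicit.
\<close>
definition matrix_rep :: "('g, 'b) monoid_scheme \<Rightarrow> nat \<Rightarrow> ('g \<Rightarrow> complex mat) \<Rightarrow> bool" where
  "matrix_rep G d \<sigma> \<longleftrightarrow> representation G \<sigma> \<and> rep_dim G \<sigma> = d"

lemma character_eq_trace: "character \<sigma> g = trace_mat (\<sigma> g)"
  by (simp add: character_def trace_mat_def)

locale fin_group = group G for G :: "('g, 'b) monoid_scheme" (structure) +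
  assumes fin: "finite (carrier G)"
begin

lemma matrix_repI:
  assumes c: "\<And>g. g \<in> carrier G \<Longrightarrow> \<sigma> g \<in> carrier_mat d d"
    and m: "\<And>g h. g \<in> carrier G \<Longrightarrow> h \<in> carrier G \<Longrightarrow> \<sigma> (g \<otimes> h) = \<sigma> g * \<sigma> h"
    and o: "\<sigma> \<one> = 1\<^sub>m d"
  shows "matrix_rep G d \<sigma>"
proof -
  have "\<sigma> g \<in> carrier (GL d)" if g: "g \<in> carrier G" for g
    using c[OF g] c[of "inv g"] m[of g "inv g"] m[of "inv g" g] g o
    by (auto simp: carrier_GL intro!: bexI[of _ "\<sigma> (inv g)"])
  then show ?thesis using m o
    by (auto simp: matrix_rep_def representation_def rep_dim_def hom_def)
qed

lemma matrix_rep_carrier: "matrix_rep G d \<sigma> \<Longrightarrow> g \<in> carrier G \<Longrightarrow> \<sigma> g \<in> carrier_mat d d"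
  by (auto simp: matrix_rep_def representation_def hom_def carrier_GL)

lemma matrix_rep_mult:
  "matrix_rep G d \<sigma> \<Longrightarrow> g \<in> carrier G \<Longrightarrow> h \<in> carrier G \<Longrightarrow> \<sigma> (g \<otimes> h) = \<sigma> g * \<sigma> h"
  by (auto simp: matrix_rep_def representation_def hom_def)

lemma matrix_rep_one: "matrix_rep G d \<sigma> \<Longrightarrow> \<sigma> \<one> = 1\<^sub>m d"
  using hom_one[of \<sigma> G "GL d"] is_group group_GL
  by (auto simp: matrix_rep_def representation_def)

lemma matrix_rep_inv:
  assumes "matrix_rep G d \<sigma>" "g \<in> carrier G"
  shows "\<sigma> g * \<sigma> (inv g) = 1\<^sub>m d" "\<sigma> (inv g) * \<sigma> g = 1\<^sub>m d"
  using assms matrix_rep_mult[OF assms(1), of g "inv g"] matrix_rep_mult[OF assms(1), of "inv g" g]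
    matrix_rep_one[OF assms(1)] by auto

lemma rep_isoI:
  assumes "matrix_rep G d \<sigma>" "matrix_rep G d \<tau>"
    and "P \<in> carrier_mat d d" "Q \<in> carrier_mat d d" "P * Q = 1\<^sub>m d" "Q * P = 1\<^sub>m d"
    and "\<And>g. g \<in> carrier G \<Longrightarrow> P * \<sigma> g = \<tau> g * P"
  shows "rep_iso G \<sigma> \<tau>"
  using assms by (auto simp: rep_iso_def matrix_rep_def carrier_GL)

lemma rep_isoE:
  assumes "rep_iso G \<sigma> \<tau>" "matrix_rep G d \<sigma>"
  obtains P Q where "P \<in> carrier_mat d d" "Q \<in> carrier_mat d d" "P * Q = 1\<^sub>m d" "Q * P = 1\<^sub>m d"
    "\<And>g. g \<in> carrier G \<Longrightarrow> P * \<sigma> g = \<tau> g * P"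
  using assms by (auto simp: rep_iso_def matrix_rep_def carrier_GL)

lemma rep_iso_refl: "matrix_rep G d \<sigma> \<Longrightarrow> rep_iso G \<sigma> \<sigma>"
  by (rule rep_isoI[of d _ _ "1\<^sub>m d" "1\<^sub>m d"]) (auto dest: matrix_rep_carrier)

lemma rep_iso_trans:
  assumes "rep_iso G \<sigma> \<tau>" "rep_iso G \<tau> \<upsilon>" "matrix_rep G d \<sigma>" "matrix_rep G d \<tau>" "matrix_rep G d \<upsilon>"
  shows "rep_iso G \<sigma> \<upsilon>"
proof -
  obtain P Q where P: "P \<in> carrier_mat d d" "Q \<in> carrier_mat d d" "P * Q = 1\<^sub>m d" "Q * P = 1\<^sub>m d"
    "\<And>g. g \<in> carrier G \<Longrightarrow> P * \<sigma> g = \<tau> g * P" using rep_isoE[OF assms(1,3)] by metis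
  obtain P' Q' where P': "P' \<in> carrier_mat d d" "Q' \<in> carrier_mat d d" "P' * Q' = 1\<^sub>m d" "Q' * P' = 1\<^sub>m d"
    "\<And>g. g \<in> carrier G \<Longrightarrow> P' * \<tau> g = \<upsilon> g * P'" using rep_isoE[OF assms(2,4)] by metis
  show ?thesis
  proof (rule rep_isoI[OF assms(3,5), of "P' * P" "Q * Q'"])
    have "P' * P * (Q * Q') = P' * (P * Q) * Q'"
      using P(1,2) P'(1,2) by (simp add: assoc_mult_mat[of _ d d _ d _ d])
    then show "P' * P * (Q * Q') = 1\<^sub>m d" using P P' by simp
    have "Q * Q' * (P' * P) = Q * (Q' * P') * P"
      using P(1,2) P'(1,2) by (simp add: assoc_mult_mat[of _ d d _ d _ d])
    then show "Q * Q' * (P' * P) = 1\<^sub>m d" using P P' by simp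
  next
    fix g assume g: "g \<in> carrier G"
    note c = matrix_rep_carrier[OF assms(3) g] matrix_rep_carrier[OF assms(4) g] matrix_rep_carrier[OF assms(5) g]
    have "P' * P * \<sigma> g = P' * (P * \<sigma> g)" using c P(1) P'(1) by (simp add: assoc_mult_mat[of _ d d _ d _ d])
    also have "\<dots> = P' * \<tau> g * P" using c P(1) P'(1) P(5)[OF g] by (simp add: assoc_mult_mat[of _ d d _ d _ d])
    also have "\<dots> = \<upsilon> g * (P' * P)" using c P(1) P'(1) P'(5)[OF g] by (simp add: assoc_mult_mat[of _ d d _ d _ d])
    finally show "P' * P * \<sigma> g = \<upsilon> g * (P' * P)" .
  qed (use P P' in auto)
qed

lemma character_rep_iso:
  assumes "rep_iso G \<sigma> \<tau>" "matrix_rep G d \<sigma>" "matrix_rep G d \<tau>" "g \<in> carrier G"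
  shows "character \<sigma> g = character \<tau> g"
proof -
  obtain P Q where P: "P \<in> carrier_mat d d" "Q \<in> carrier_mat d d" "P * Q = 1\<^sub>m d" "Q * P = 1\<^sub>m d"
    "\<And>g. g \<in> carrier G \<Longrightarrow> P * \<sigma> g = \<tau> g * P" using rep_isoE[OF assms(1,2)] by metis
  note c = matrix_rep_carrier[OF assms(2,4)] matrix_rep_carrier[OF assms(3,4)]
  have "trace_mat (\<tau> g) = trace_mat (\<tau> g * P * Q)"
    using c P by (simp add: assoc_mult_mat[of _ d d _ d _ d])
  also have "\<dots> = trace_mat (Q * (P * \<sigma> g))"
    using P c assms(4) by (subst trace_mat_mult_comm[of _ d d]) auto
  also have "Q * (P * \<sigma> g) = Q * P * \<sigma> g"
    using P(1,2) c by (simp add: assoc_mult_mat[of _ d d _ d _ d])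
  also have "\<dots> = \<sigma> g" using P(4) c by simp
  finally show ?thesis by (simp add: character_eq_trace)
qed

section \<open>Sums of matrices over the group\<close>

text \<open>
  Matrices of varying dimensions are not an instance of a type class of commutative monoids, so the sum is
  formed entrywise and the dimensions are passed explicitly.
\<close>
definition group_sum :: "nat \<Rightarrow> nat \<Rightarrow> ('g \<Rightarrow> complex mat) \<Rightarrow> complex mat" where
  "group_sum e d F = mat e d (\<lambda>ij. \<Sum>g\<in>carrier G. F g $$ ij)"

lemma group_sum_carrier [simp]: "group_sum e d F \<in> carrier_mat e d"
  by (simp add: group_sum_def)

lemma mult_group_sum:
  assumes "A \<in> carrier_mat c e" "\<And>g. g \<in> carrier G \<Longrightarrow> F g \<in> carrier_mat e d"
  shows "A * group_sum e d F = group_sum c d (\<lambda>g. A * F g)"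
proof (rule eq_matI)
  fix i j assume "i < dim_row (group_sum c d (\<lambda>g. A * F g))" "j < dim_col (group_sum c d (\<lambda>g. A * F g))"
  then have ij: "i < c" "j < d" by (auto simp: group_sum_def)
  have "(A * group_sum e d F) $$ (i, j) = (\<Sum>k<e. \<Sum>g\<in>carrier G. A $$ (i, k) * F g $$ (k, j))"
    using assms(1) ij
    by (simp add: group_sum_def scalar_prod_def lessThan_atLeast0 sum_distrib_left)
  also have "\<dots> = (\<Sum>g\<in>carrier G. \<Sum>k<e. A $$ (i, k) * F g $$ (k, j))" by (rule sum.swap)
  also have "\<dots> = (\<Sum>g\<in>carrier G. (A * F g) $$ (i, j))"
  proof (rule sum.cong)
    fix g assume "g \<in> carrier G"
    then show "(\<Sum>k<e. A $$ (i, k) * F g $$ (k, j)) = (A * F g) $$ (i, j)"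
      using assms(1) assms(2)[of g] ij by (simp add: scalar_prod_def lessThan_atLeast0)
  qed simp
  finally show "(A * group_sum e d F) $$ (i, j) = group_sum c d (\<lambda>g. A * F g) $$ (i, j)"
    using ij by (simp add: group_sum_def)
qed (use assms in \<open>auto simp: group_sum_def\<close>)

lemma group_sum_mult:
  assumes "A \<in> carrier_mat d c" "\<And>g. g \<in> carrier G \<Longrightarrow> F g \<in> carrier_mat e d"
  shows "group_sum e d F * A = group_sum e c (\<lambda>g. F g * A)"
proof (rule eq_matI)
  fix i j assume "i < dim_row (group_sum e c (\<lambda>g. F g * A))" "j < dim_col (group_sum e c (\<lambda>g. F g * A))"
  then have ij: "i < e" "j < c" by (auto simp: group_sum_def)
  have "(group_sum e d F * A) $$ (i, j) = (\<Sum>k<d. \<Sum>g\<in>carrier G. F g $$ (i, k) * A $$ (k, j))"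
    using assms(1) ij
    by (simp add: group_sum_def scalar_prod_def lessThan_atLeast0 sum_distrib_right)
  also have "\<dots> = (\<Sum>g\<in>carrier G. \<Sum>k<d. F g $$ (i, k) * A $$ (k, j))" by (rule sum.swap)
  also have "\<dots> = (\<Sum>g\<in>carrier G. (F g * A) $$ (i, j))"
  proof (rule sum.cong)
    fix g assume "g \<in> carrier G"
    then show "(\<Sum>k<d. F g $$ (i, k) * A $$ (k, j)) = (F g * A) $$ (i, j)"
      using assms(1) assms(2)[of g] ij by (simp add: scalar_prod_def lessThan_atLeast0)
  qed simp
  finally show "(group_sum e d F * A) $$ (i, j) = group_sum e c (\<lambda>g. F g * A) $$ (i, j)"
    using ij by (simp add: group_sum_def)
qed (use assms in \<open>auto simp: group_sum_def\<close>)

lemma group_sum_cong: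
  "(\<And>g. g \<in> carrier G \<Longrightarrow> F g = F' g) \<Longrightarrow> group_sum e d F = group_sum e d F'"
  by (simp add: group_sum_def)

lemma sum_translate:
  assumes "h \<in> carrier G"
  shows "(\<Sum>g\<in>carrier G. f (h \<otimes> g)) = (\<Sum>g\<in>carrier G. f g)"
  using assms
  by (intro sum.reindex_bij_witness[of _ "\<lambda>g. inv h \<otimes> g" "\<lambda>g. h \<otimes> g"])
     (auto simp: m_assoc[symmetric])

lemma group_sum_translate:
  "h \<in> carrier G \<Longrightarrow> group_sum e d (\<lambda>g. F (h \<otimes> g)) = group_sum e d F"
  unfolding group_sum_def by (intro cong_mat refl sum_translate)

lemma group_sum_add:
  assumes "\<And>g. g \<in> carrier G \<Longrightarrow> F g \<in> carrier_mat e d" "\<And>g. g \<in> carrier G \<Longrightarrow> F' g \<in> carrier_mat e d"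
  shows "group_sum e d (\<lambda>g. F g + F' g) = group_sum e d F + group_sum e d F'"
proof (rule eq_matI)
  fix i j assume "i < dim_row (group_sum e d F + group_sum e d F')" "j < dim_col (group_sum e d F + group_sum e d F')"
  then have ij: "i < e" "j < d" by (auto simp: group_sum_def)
  have "(F g + F' g) $$ (i, j) = F g $$ (i, j) + F' g $$ (i, j)" if "g \<in> carrier G" for g
    using assms(2)[OF that] ij by auto
  then show "group_sum e d (\<lambda>g. F g + F' g) $$ (i, j) = (group_sum e d F + group_sum e d F') $$ (i, j)"
    using ij by (simp add: group_sum_def sum.distrib)
qed (auto simp: group_sum_def)

lemma group_sum_const:
  "A \<in> carrier_mat e d \<Longrightarrow> group_sum e d (\<lambda>g. A) = of_nat (card (carrier G)) \<cdot>\<^sub>m A"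
  by (intro eq_matI) (auto simp: group_sum_def)

section \<open>Schur's lemma and orthogonality of characters\<close>

lemma irreducible_rep_iff:
  assumes "matrix_rep G d \<sigma>"
  shows "irreducible_rep G \<sigma> \<longleftrightarrow> d > 0 \<and>
    (\<forall>W. vec_closed d W \<and> (\<forall>g\<in>carrier G. \<forall>w\<in>W. \<sigma> g *\<^sub>v w \<in> W) \<longrightarrow> W = {0\<^sub>v d} \<or> W = carrier_vec d)"
  using assms by (simp add: irreducible_rep_def matrix_rep_def subspace_iff_vec_closed)

text \<open>
  The kernel of an intertwiner is invariant under the group.
\<close>
lemma intertwiner_kernel:
  assumes \<sigma>: "matrix_rep G d \<sigma>" "irreducible_rep G \<sigma>" and \<tau>: "matrix_rep G e \<tau>"
    and T: "T \<in> carrier_mat e d" "\<And>g. g \<in> carrier G \<Longrightarrow> T * \<sigma> g = \<tau> g * T"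
  shows "T = 0\<^sub>m e d \<or> (\<forall>v\<in>carrier_vec d. T *\<^sub>v v = 0\<^sub>v e \<longrightarrow> v = 0\<^sub>v d)"
proof -
  let ?W = "{v \<in> carrier_vec d. T *\<^sub>v v = 0\<^sub>v e}"
  have "vec_closed d ?W"
    using T(1) by (auto simp: vec_closed_def mult_add_distrib_mat_vec mult_mat_vec)
  moreover have "\<sigma> g *\<^sub>v w \<in> ?W" if g: "g \<in> carrier G" and w: "w \<in> ?W" for g w
  proof -
    note c = matrix_rep_carrier[OF \<sigma>(1) g] matrix_rep_carrier[OF \<tau> g]
    have "T *\<^sub>v (\<sigma> g *\<^sub>v w) = T * \<sigma> g *\<^sub>v w" using c T(1) w by (simp add: assoc_mult_mat_vec)
    also have "\<dots> = \<tau> g *\<^sub>v (T *\<^sub>v w)" using c T(1) w g T(2) by (simp add: assoc_mult_mat_vec)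
    also have "\<dots> = 0\<^sub>v e" using w c by (auto intro!: eq_vecI)
    finally show ?thesis using c w by auto
  qed
  ultimately have "?W = {0\<^sub>v d} \<or> ?W = carrier_vec d"
    using irreducible_rep_iff[OF \<sigma>(1)] \<sigma>(2) by blast
  then show ?thesis
  proof
    assume "?W = carrier_vec d"
    then have z: "\<And>v. v \<in> carrier_vec d \<Longrightarrow> T *\<^sub>v v = 0\<^sub>v e" by blast
    have "T = 0\<^sub>m e d"
    proof (rule mat_col_eqI)
      fix j assume "j < dim_col (0\<^sub>m e d :: complex mat)"
      then have "j < d" by simp
      then show "col T j = col (0\<^sub>m e d) j"
        using z[of "unit_vec d j"] mult_mat_unit_vec[OF T(1)] by simp
    qed (use T in auto)
    then show ?thesis ..
  qed blast
qed

text \<open>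
  The range of an intertwiner is invariant under the group.
\<close>
lemma intertwiner_range:
  assumes \<sigma>: "matrix_rep G d \<sigma>" and \<tau>: "matrix_rep G e \<tau>" "irreducible_rep G \<tau>"
    and T: "T \<in> carrier_mat e d" "\<And>g. g \<in> carrier G \<Longrightarrow> T * \<sigma> g = \<tau> g * T"
  shows "(\<lambda>v. T *\<^sub>v v) ` carrier_vec d = {0\<^sub>v e} \<or> (\<lambda>v. T *\<^sub>v v) ` carrier_vec d = carrier_vec e"
proof -
  let ?W = "(\<lambda>v. T *\<^sub>v v) ` carrier_vec d"
  have "0\<^sub>v e \<in> ?W" using T(1) by (intro image_eqI[of _ _ "0\<^sub>v d"]) auto
  moreover have "T *\<^sub>v v + T *\<^sub>v w \<in> ?W" if "v \<in> carrier_vec d" "w \<in> carrier_vec d" for v w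
    using that T(1) by (intro image_eqI[of _ _ "v + w"]) (auto simp: mult_add_distrib_mat_vec)
  moreover have "c \<cdot>\<^sub>v (T *\<^sub>v v) \<in> ?W" if "v \<in> carrier_vec d" for v c
    using that T(1) by (intro image_eqI[of _ _ "c \<cdot>\<^sub>v v"]) (auto simp: mult_mat_vec)
  ultimately have "vec_closed e ?W" using T(1) by (auto simp: vec_closed_def)
  moreover have "\<tau> g *\<^sub>v w \<in> ?W" if g: "g \<in> carrier G" and w: "w \<in> ?W" for g w
  proof -
    note c = matrix_rep_carrier[OF \<sigma> g] matrix_rep_carrier[OF \<tau>(1) g]
    obtain v where v: "v \<in> carrier_vec d" "w = T *\<^sub>v v" using w by auto
    have "\<tau> g *\<^sub>v w = \<tau> g * T *\<^sub>v v" using c T(1) v by (simp add: assoc_mult_mat_vec)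
    also have "\<dots> = T *\<^sub>v (\<sigma> g *\<^sub>v v)" using c T v g by (simp flip: T(2) add: assoc_mult_mat_vec)
    finally show ?thesis using c v by auto
  qed
  ultimately show ?thesis using irreducible_rep_iff[OF \<tau>(1)] \<tau>(2) by blast
qed

lemma schur_non_iso:
  assumes \<sigma>: "matrix_rep G d \<sigma>" "irreducible_rep G \<sigma>" and \<tau>: "matrix_rep G e \<tau>" "irreducible_rep G \<tau>"
    and T: "T \<in> carrier_mat e d" "\<And>g. g \<in> carrier G \<Longrightarrow> T * \<sigma> g = \<tau> g * T"
    and noniso: "\<not> rep_iso G \<sigma> \<tau>"
  shows "T = 0\<^sub>m e d"
proof (rule ccontr)
  assume nz: "T \<noteq> 0\<^sub>m e d"
  have inj: "\<And>v. v \<in> carrier_vec d \<Longrightarrow> T *\<^sub>v v = 0\<^sub>v e \<Longrightarrow> v = 0\<^sub>v d"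
    using intertwiner_kernel[OF \<sigma> \<tau>(1) T] nz by blast
  have d: "d > 0" using irreducible_rep_iff[OF \<sigma>(1)] \<sigma>(2) by blast
  have "unit_vec d 0 \<noteq> (0\<^sub>v d :: complex vec)" using d
    by (metis index_unit_vec(1) index_zero_vec(1) zero_neq_one)
  then have "T *\<^sub>v unit_vec d 0 \<noteq> 0\<^sub>v e" using inj by auto
  then have "(\<lambda>v. T *\<^sub>v v) ` carrier_vec d \<noteq> {0\<^sub>v e}" by auto
  then have im: "(\<lambda>v. T *\<^sub>v v) ` carrier_vec d = carrier_vec e"
    using intertwiner_range[OF \<sigma>(1) \<tau> T] by blast
  then have surj: "\<And>w. w \<in> carrier_vec e \<Longrightarrow> \<exists>v\<in>carrier_vec d. T *\<^sub>v v = w"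
    by (metis imageE)
  have "d = e" using bijective_mat_inverse(1)[OF T(1) inj surj] by blast
  moreover obtain S where "S \<in> carrier_mat d d" "T * S = 1\<^sub>m d" "S * T = 1\<^sub>m d"
    using bijective_mat_inverse(2)[OF T(1) inj surj] by blast
  ultimately have "rep_iso G \<sigma> \<tau>"
    using rep_isoI[OF \<sigma>(1), of \<tau> T S] \<tau>(1) T by auto
  with noniso show False by simp
qed

text \<open>
  For an eigenvalue \<open>c\<close> of \<open>T\<close>, which exists over \<open>\<complex>\<close>, the intertwiner \<open>T - c\<close> has a nonzero kernel and
  therefore vanishes.
\<close>
lemma schur_scalar:
  assumes \<sigma>: "matrix_rep G d \<sigma>" "irreducible_rep G \<sigma>"
    and T: "T \<in> carrier_mat d d" "\<And>g. g \<in> carrier G \<Longrightarrow> T * \<sigma> g = \<sigma> g * T"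
  shows "\<exists>c. T = c \<cdot>\<^sub>m 1\<^sub>m d"
proof -
  have d: "d > 0" using irreducible_rep_iff[OF \<sigma>(1)] \<sigma>(2) by blast
  obtain c where "eigenvalue T c" using spectrum_non_empty[OF T(1) d] by (auto simp: spectrum_def)
  then obtain v where v: "v \<in> carrier_vec d" "v \<noteq> 0\<^sub>v d" "T *\<^sub>v v = c \<cdot>\<^sub>v v"
    using T(1) by (auto simp: eigenvalue_def eigenvector_def)
  let ?S = "T - c \<cdot>\<^sub>m 1\<^sub>m d"
  have S: "?S \<in> carrier_mat d d" using T(1) by auto
  have com: "?S * \<sigma> g = \<sigma> g * ?S" if g: "g \<in> carrier G" for g
  proof -
    note c = matrix_rep_carrier[OF \<sigma>(1) g]
    have "?S * \<sigma> g = T * \<sigma> g - c \<cdot>\<^sub>m \<sigma> g"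
      using c T(1) by (subst minus_mult_distrib_mat[of _ d d]) (auto simp: mult_smult_assoc_mat[of _ d d])
    also have "\<dots> = \<sigma> g * ?S"
      using c T g by (subst mult_minus_distrib_mat[of _ d d]) (auto simp: mult_smult_distrib[of _ d d])
    finally show ?thesis .
  qed
  have "c \<cdot>\<^sub>m 1\<^sub>m d *\<^sub>v v = c \<cdot>\<^sub>v v" using v(1)
    by (intro eq_vecI) auto
  then have "?S *\<^sub>v v = 0\<^sub>v d" using v T(1) by (subst minus_mult_distrib_mat_vec[of _ d d]) auto
  then have "?S = 0\<^sub>m d d" using intertwiner_kernel[OF \<sigma> \<sigma>(1) S com] v by blast
  have "T = c \<cdot>\<^sub>m 1\<^sub>m d"
  proof (rule eq_matI)
    fix i j assume ij: "i < dim_row (c \<cdot>\<^sub>m 1\<^sub>m d)" "j < dim_col (c \<cdot>\<^sub>m 1\<^sub>m d)"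
    then have "?S $$ (i, j) = 0" using \<open>?S = 0\<^sub>m d d\<close> by simp
    then show "T $$ (i, j) = (c \<cdot>\<^sub>m 1\<^sub>m d) $$ (i, j)" using ij T(1) by simp
  qed (use T in auto)
  then show ?thesis ..
qed

text \<open>
  Multiplying the average by \<open>\<tau> h\<close> on the left and by the inverse of \<open>\<sigma> h\<close> on the right translates the
  summation index by \<open>h\<close>.
\<close>
lemma average_intertwines:
  assumes \<sigma>: "matrix_rep G d \<sigma>" and \<tau>: "matrix_rep G e \<tau>" and X: "X \<in> carrier_mat e d" and h: "h \<in> carrier G"
  defines "T \<equiv> group_sum e d (\<lambda>g. \<tau> g * X * \<sigma> (inv g))"
  shows "T * \<sigma> h = \<tau> h * T"
proof -
  have c: "\<And>g. g \<in> carrier G \<Longrightarrow> \<tau> g * X * \<sigma> (inv g) \<in> carrier_mat e d"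
    using matrix_rep_carrier[OF \<sigma>] matrix_rep_carrier[OF \<tau>] X
    by (meson inv_closed mult_carrier_mat)
  have "\<tau> h * T = group_sum e d (\<lambda>g. \<tau> h * (\<tau> g * X * \<sigma> (inv g)))"
    unfolding T_def by (rule mult_group_sum[OF matrix_rep_carrier[OF \<tau> h] c])
  also have "\<dots> = group_sum e d (\<lambda>g. (\<tau> (h \<otimes> g) * X * \<sigma> (inv (h \<otimes> g))) * \<sigma> h)"
  proof (rule group_sum_cong)
    fix g assume g: "g \<in> carrier G"
    have i: "inv g = inv (h \<otimes> g) \<otimes> h" using g h by (simp add: inv_mult_group m_assoc)
    note cs = matrix_rep_carrier[OF \<tau> h] matrix_rep_carrier[OF \<tau> g]
       matrix_rep_carrier[OF \<sigma> h] matrix_rep_carrier[OF \<sigma> inv_closed[OF m_closed[OF h g]]]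
    have "\<sigma> (inv g) = \<sigma> (inv (h \<otimes> g)) * \<sigma> h" by (subst i) (use g h matrix_rep_mult[OF \<sigma>] in auto)
    then show "\<tau> h * (\<tau> g * X * \<sigma> (inv g)) = (\<tau> (h \<otimes> g) * X * \<sigma> (inv (h \<otimes> g))) * \<sigma> h"
      using g h cs X matrix_rep_mult[OF \<tau> h g]
      by (simp add: assoc_mult_mat[of _ e e _ e _ d] assoc_mult_mat[of _ e e _ d _ d] assoc_mult_mat[of _ e d _ d _ d]
         mult_carrier_mat[of _ e d _ d] mult_carrier_mat[of _ d d _ d])
  qed
  also have "\<dots> = group_sum e d (\<lambda>g. (\<tau> g * X * \<sigma> (inv g)) * \<sigma> h)"
    by (rule group_sum_translate[OF h])
  also have "\<dots> = T * \<sigma> h"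
    unfolding T_def by (rule group_sum_mult[OF matrix_rep_carrier[OF \<sigma> h] c, symmetric])
  finally show ?thesis by simp
qed

text \<open>
  On characters this is the order of the group times the usual Hermitian inner product: there the value at
  the inverse is the complex conjugate. Writing the inverse avoids any reference to unitary matrices.
\<close>
definition char_pairing :: "('g \<Rightarrow> complex) \<Rightarrow> ('g \<Rightarrow> complex) \<Rightarrow> complex" where
  "char_pairing \<chi> \<psi> = (\<Sum>g\<in>carrier G. \<chi> g * \<psi> (inv g))"

lemma unit_mat_sandwich:
  fixes A B :: "complex mat"
  assumes "A \<in> carrier_mat e e" "B \<in> carrier_mat d d" "a < e" "b < d"
  shows "(A * mat e d (\<lambda>ij. if ij = (a, b) then 1 else 0) * B) $$ (a, b) = A $$ (a, a) * B $$ (b, b)"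
proof -
  let ?E = "mat e d (\<lambda>ij. if ij = (a, b) then 1 else 0) :: complex mat"
  have "(A * ?E) $$ (a, j) = (if j = b then A $$ (a, a) else 0)" if j: "j < d" for j
  proof -
    have "(A * ?E) $$ (a, j) = (\<Sum>k\<in>{0..<e}. if k = a then (if j = b then A $$ (a, a) else 0) else 0)"
      using assms j by (auto simp: scalar_prod_def simp del: sum.delta intro!: sum.cong)
    then show ?thesis using assms(3) by simp
  qed
  then have "(A * ?E * B) $$ (a, b) = (\<Sum>j\<in>{0..<d}. (if j = b then A $$ (a, a) else 0) * B $$ (j, b))"
    using assms by (subst index_mult_mat) (auto simp: scalar_prod_def intro!: sum.cong simp del: index_mult_mat(1))
  also have "\<dots> = (\<Sum>j\<in>{0..<d}. if j = b then A $$ (a, a) * B $$ (b, b) else 0)"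
    by (intro sum.cong) auto
  finally show ?thesis using assms(4) by simp
qed

text \<open>
  The product of the diagonal entries \<open>(a, a)\<close> of \<open>\<tau> g\<close> and \<open>(b, b)\<close> of \<open>\<sigma> g\<^sup>-\<^sup>1\<close> is the entry \<open>(a, b)\<close> of
  the matrix unit at \<open>(a, b)\<close> multiplied by \<open>\<tau> g\<close> and \<open>\<sigma> g\<^sup>-\<^sup>1\<close>. This turns the pairing of characters into entries
  of averages, to which Schur's lemma applies.
\<close>
lemma char_pairing_average:
  assumes \<sigma>: "matrix_rep G d \<sigma>" and \<tau>: "matrix_rep G e \<tau>"
  shows "char_pairing (character \<tau>) (character \<sigma>) =
    (\<Sum>a<e. \<Sum>b<d. group_sum e d (\<lambda>g. \<tau> g * mat e d (\<lambda>ij. if ij = (a, b) then 1 else 0) * \<sigma> (inv g)) $$ (a, b))"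
proof -
  have "char_pairing (character \<tau>) (character \<sigma>)
     = (\<Sum>g\<in>carrier G. (\<Sum>a<e. \<tau> g $$ (a, a)) * (\<Sum>b<d. \<sigma> (inv g) $$ (b, b)))"
    unfolding char_pairing_def
    using carrier_matD(1)[OF matrix_rep_carrier[OF \<sigma>]] carrier_matD(1)[OF matrix_rep_carrier[OF \<tau>]]
    by (simp add: character_def)
  also have "\<dots> = (\<Sum>g\<in>carrier G. \<Sum>a<e. \<Sum>b<d. \<tau> g $$ (a, a) * \<sigma> (inv g) $$ (b, b))"
    by (simp add: sum_product)
  also have "\<dots> = (\<Sum>a<e. \<Sum>b<d. \<Sum>g\<in>carrier G. \<tau> g $$ (a, a) * \<sigma> (inv g) $$ (b, b))"
    by (subst sum.swap, rule sum.cong[OF refl], rule sum.swap)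
  also have "\<dots> = (\<Sum>a<e. \<Sum>b<d. group_sum e d (\<lambda>g. \<tau> g * mat e d (\<lambda>ij. if ij = (a, b) then 1 else 0) * \<sigma> (inv g)) $$ (a, b))"
    using matrix_rep_carrier[OF \<sigma>] matrix_rep_carrier[OF \<tau>]
    by (auto simp: group_sum_def unit_mat_sandwich[of _ e _ d] intro!: sum.cong simp del: index_mult_mat)
  finally show ?thesis .
qed

lemma char_pairing_non_iso:
  assumes "matrix_rep G d \<sigma>" "irreducible_rep G \<sigma>" "matrix_rep G e \<tau>" "irreducible_rep G \<tau>"
    and "\<not> rep_iso G \<sigma> \<tau>"
  shows "char_pairing (character \<tau>) (character \<sigma>) = 0"
proof -
  have "group_sum e d (\<lambda>g. \<tau> g * X * \<sigma> (inv g)) = 0\<^sub>m e d" if "X \<in> carrier_mat e d" for X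
    using schur_non_iso[OF assms(1-4) _ _ assms(5)] average_intertwines[OF assms(1,3) that] by simp
  then show ?thesis by (simp add: char_pairing_average[OF assms(1,3)])
qed

text \<open>
  By Schur's lemma the average of \<open>X\<close> is a scalar matrix, and comparing traces determines the scalar as
  \<open>|G| tr X / d\<close>. For the matrix unit at \<open>(a, b)\<close> this is nonzero only when \<open>a = b\<close>, so that \<open>d\<close> terms
  \<open>|G| / d\<close> remain.
\<close>
lemma char_pairing_self:
  assumes \<sigma>: "matrix_rep G d \<sigma>" "irreducible_rep G \<sigma>"
  shows "char_pairing (character \<sigma>) (character \<sigma>) = of_nat (card (carrier G))"
proof -
  have d: "d > 0" using irreducible_rep_iff[OF \<sigma>(1)] \<sigma>(2) by blast
  have key: "group_sum d d (\<lambda>g. \<sigma> g * X * \<sigma> (inv g)) =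
      (of_nat (card (carrier G)) * trace_mat X / of_nat d) \<cdot>\<^sub>m 1\<^sub>m d" if X: "X \<in> carrier_mat d d" for X
  proof -
    let ?T = "group_sum d d (\<lambda>g. \<sigma> g * X * \<sigma> (inv g))"
    obtain c where c: "?T = c \<cdot>\<^sub>m 1\<^sub>m d"
      using schur_scalar[OF \<sigma> group_sum_carrier average_intertwines[OF \<sigma>(1,1) X]] by blast
    have "trace_mat ?T = c * of_nat d" unfolding c by (simp add: trace_mat_def)
    moreover have "trace_mat ?T = (\<Sum>g\<in>carrier G. trace_mat (\<sigma> g * X * \<sigma> (inv g)))"
      using carrier_matD(1)[OF matrix_rep_carrier[OF \<sigma>(1)]]
      by (simp add: trace_mat_def group_sum_def) (rule sum.swap)
    moreover have "trace_mat (\<sigma> g * X * \<sigma> (inv g)) = trace_mat X" if g: "g \<in> carrier G" for g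
    proof -
      note cs = matrix_rep_carrier[OF \<sigma>(1) g] matrix_rep_carrier[OF \<sigma>(1) inv_closed[OF g]]
      have "trace_mat (\<sigma> g * X * \<sigma> (inv g)) = trace_mat (\<sigma> (inv g) * (\<sigma> g * X))"
        using cs X by (intro trace_mat_mult_comm[of _ d d]) auto
      also have "\<sigma> (inv g) * (\<sigma> g * X) = (\<sigma> (inv g) * \<sigma> g) * X"
        using cs X by (simp add: assoc_mult_mat[of _ d d _ d _ d])
      also have "\<dots> = X" using X matrix_rep_inv[OF \<sigma>(1) g] by simp
      finally show ?thesis .
    qed
    ultimately have "c * of_nat d = of_nat (card (carrier G)) * trace_mat X" by simp
    then have "c = of_nat (card (carrier G)) * trace_mat X / of_nat d" using d by (simp add: field_simps)
    then show ?thesis using c by simp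
  qed
  have tr: "trace_mat (mat d d (\<lambda>ij. if ij = (a, b) then 1 else 0) :: complex mat) = (if a = b then 1 else 0)"
    if "a < d" for a b
    using that by (auto simp: trace_mat_def)
  have "char_pairing (character \<sigma>) (character \<sigma>) =
    (\<Sum>a<d. \<Sum>b<d. if a = b then of_nat (card (carrier G)) / of_nat d else 0)"
    unfolding char_pairing_average[OF \<sigma>(1,1)]
    by (intro sum.cong refl) (auto simp: key tr)
  also have "\<dots> = of_nat (card (carrier G))" using d by simp
  finally show ?thesis .
qed

end

section \<open>Direct sums\<close>

definition dsum_rep :: "('g \<Rightarrow> complex mat) \<Rightarrow> ('g \<Rightarrow> complex mat) \<Rightarrow> 'g \<Rightarrow> complex mat" where
  "dsum_rep \<sigma> \<tau> g = four_block_mat (\<sigma> g) (0\<^sub>m (dim_row (\<sigma> g)) (dim_col (\<tau> g)))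
     (0\<^sub>m (dim_row (\<tau> g)) (dim_col (\<sigma> g))) (\<tau> g)"

text \<open>
  Indexing the summands by a list, instead of by a multiplicity function, lets direct sums be concatenated
  and reordered.
\<close>
definition list_rep :: "(nat \<Rightarrow> 'g \<Rightarrow> complex mat) \<Rightarrow> nat list \<Rightarrow> 'g \<Rightarrow> complex mat" where
  "list_rep \<rho> L g = diag_block_mat (map (\<lambda>j. \<rho> j g) L)"

lemma list_rep_Cons: "list_rep \<rho> (i # L) = dsum_rep (\<rho> i) (list_rep \<rho> L)"
  by (rule ext) (simp add: list_rep_def dsum_rep_def Let_def)

lemma list_rep_append: "list_rep \<rho> (L @ L') = dsum_rep (list_rep \<rho> L) (list_rep \<rho> L')"
  by (rule ext) (simp add: list_rep_def dsum_rep_def Let_def diag_block_mat_append)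

lemma list_rep_single: "list_rep \<rho> [i] = \<rho> i"
  by (rule ext) (simp add: list_rep_def del: diag_block_mat.simps)

lemma sum_rep_eq_list_rep:
  "sum_rep s m \<rho> = list_rep \<rho> (concat (map (\<lambda>j. replicate (m j) j) [0..<Suc s]))"
  by (rule ext) (simp add: sum_rep_def list_rep_def map_concat o_def del: upt_Suc)

lemma count_mset_concat_replicate:
  "count (mset (concat (map (\<lambda>j. replicate (f j) j) K))) i = (\<Sum>j\<leftarrow>K. if j = i then f j else 0)"
  by (induction K) auto

context fin_group
begin

lemma dsum_rep_eq:
  assumes "matrix_rep G d \<sigma>" "matrix_rep G e \<tau>" "g \<in> carrier G"
  shows "dsum_rep \<sigma> \<tau> g = four_block_mat (\<sigma> g) (0\<^sub>m d e) (0\<^sub>m e d) (\<tau> g)"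
  using matrix_rep_carrier[OF assms(1,3)] matrix_rep_carrier[OF assms(2,3)]
  by (simp add: dsum_rep_def)

lemma matrix_rep_dsum:
  assumes \<sigma>: "matrix_rep G d \<sigma>" and \<tau>: "matrix_rep G e \<tau>"
  shows "matrix_rep G (d + e) (dsum_rep \<sigma> \<tau>)"
proof (rule matrix_repI)
  fix g assume g: "g \<in> carrier G"
  note c = matrix_rep_carrier[OF \<sigma> g] matrix_rep_carrier[OF \<tau> g]
  show "dsum_rep \<sigma> \<tau> g \<in> carrier_mat (d + e) (d + e)"
    using c by (simp add: dsum_rep_eq[OF \<sigma> \<tau> g])
  fix h assume h: "h \<in> carrier G"
  note c' = matrix_rep_carrier[OF \<sigma> h] matrix_rep_carrier[OF \<tau> h]
  show "dsum_rep \<sigma> \<tau> (g \<otimes> h) = dsum_rep \<sigma> \<tau> g * dsum_rep \<sigma> \<tau> h"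
    using c c' g h
    by (simp add: dsum_rep_eq[OF \<sigma> \<tau>] mult_four_block_mat[of _ d d _ e _ e _ _ d _ e]
        matrix_rep_mult[OF \<sigma>] matrix_rep_mult[OF \<tau>])
next
  show "dsum_rep \<sigma> \<tau> \<one> = 1\<^sub>m (d + e)"
    by (simp add: dsum_rep_eq[OF \<sigma> \<tau>] matrix_rep_one[OF \<sigma>] matrix_rep_one[OF \<tau>])
qed

lemma character_dsum:
  assumes \<sigma>: "matrix_rep G d \<sigma>" and \<tau>: "matrix_rep G e \<tau>" and g: "g \<in> carrier G"
  shows "character (dsum_rep \<sigma> \<tau>) g = character \<sigma> g + character \<tau> g"
  using matrix_rep_carrier[OF \<sigma> g] matrix_rep_carrier[OF \<tau> g]
  by (simp add: character_eq_trace dsum_rep_eq[OF \<sigma> \<tau> g] trace_mat_four_block[of _ d _ e])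

lemma rep_iso_dsum_cong:
  assumes "rep_iso G \<sigma> \<sigma>'" "rep_iso G \<tau> \<tau>'"
    and \<sigma>: "matrix_rep G d \<sigma>" "matrix_rep G d \<sigma>'" and \<tau>: "matrix_rep G e \<tau>" "matrix_rep G e \<tau>'"
  shows "rep_iso G (dsum_rep \<sigma> \<tau>) (dsum_rep \<sigma>' \<tau>')"
proof -
  obtain P Q where P: "P \<in> carrier_mat d d" "Q \<in> carrier_mat d d" "P * Q = 1\<^sub>m d" "Q * P = 1\<^sub>m d"
    "\<And>g. g \<in> carrier G \<Longrightarrow> P * \<sigma> g = \<sigma>' g * P" using rep_isoE[OF assms(1) \<sigma>(1)] by metis
  obtain P' Q' where P': "P' \<in> carrier_mat e e" "Q' \<in> carrier_mat e e" "P' * Q' = 1\<^sub>m e" "Q' * P' = 1\<^sub>m e"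
    "\<And>g. g \<in> carrier G \<Longrightarrow> P' * \<tau> g = \<tau>' g * P'" using rep_isoE[OF assms(2) \<tau>(1)] by metis
  note simps = mult_four_block_mat[of _ d d _ e _ e _ _ d _ e]
  show ?thesis
  proof (rule rep_isoI[OF matrix_rep_dsum[OF \<sigma>(1) \<tau>(1)] matrix_rep_dsum[OF \<sigma>(2) \<tau>(2)]])
    show "four_block_mat P (0\<^sub>m d e) (0\<^sub>m e d) P' * four_block_mat Q (0\<^sub>m d e) (0\<^sub>m e d) Q' = 1\<^sub>m (d + e)"
      "four_block_mat Q (0\<^sub>m d e) (0\<^sub>m e d) Q' * four_block_mat P (0\<^sub>m d e) (0\<^sub>m e d) P' = 1\<^sub>m (d + e)"
      using P P' by (simp_all add: simps)
    fix g assume g: "g \<in> carrier G"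
    note c = matrix_rep_carrier[OF \<sigma>(1) g] matrix_rep_carrier[OF \<tau>(1) g]
      matrix_rep_carrier[OF \<sigma>(2) g] matrix_rep_carrier[OF \<tau>(2) g]
    show "four_block_mat P (0\<^sub>m d e) (0\<^sub>m e d) P' * dsum_rep \<sigma> \<tau> g
        = dsum_rep \<sigma>' \<tau>' g * four_block_mat P (0\<^sub>m d e) (0\<^sub>m e d) P'"
      using P P' c g by (simp add: simps dsum_rep_eq[OF \<sigma>(1) \<tau>(1)] dsum_rep_eq[OF \<sigma>(2) \<tau>(2)])
  qed (use P P' in auto)
qed

text \<open>
  The intertwiner exchanges the two blocks of coordinates.
\<close>
lemma rep_iso_dsum_comm:
  assumes \<sigma>: "matrix_rep G d \<sigma>" and \<tau>: "matrix_rep G e \<tau>"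
  shows "rep_iso G (dsum_rep \<sigma> \<tau>) (dsum_rep \<tau> \<sigma>)"
proof (rule rep_isoI[OF matrix_rep_dsum[OF \<sigma> \<tau>]])
  let ?P = "four_block_mat (0\<^sub>m e d) (1\<^sub>m e) (1\<^sub>m d) (0\<^sub>m d e) :: complex mat"
  let ?Q = "four_block_mat (0\<^sub>m d e) (1\<^sub>m d) (1\<^sub>m e) (0\<^sub>m e d) :: complex mat"
  show "matrix_rep G (d + e) (dsum_rep \<tau> \<sigma>)" using matrix_rep_dsum[OF \<tau> \<sigma>] by (simp add: add.commute)
  have "?P \<in> carrier_mat (e + d) (d + e)" by (rule four_block_carrier_mat) auto
  then show "?P \<in> carrier_mat (d + e) (d + e)" by (simp add: add.commute)
  have "?Q \<in> carrier_mat (d + e) (e + d)" by (rule four_block_carrier_mat) auto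
  then show "?Q \<in> carrier_mat (d + e) (d + e)" by (simp add: add.commute)
  show "?P * ?Q = 1\<^sub>m (d + e)"
    by (simp add: mult_four_block_mat[of _ e d _ e _ d _ _ e _ d] add.commute[of d e])
  show "?Q * ?P = 1\<^sub>m (d + e)"
    by (simp add: mult_four_block_mat[of _ d e _ d _ e _ _ d _ e])
  fix g assume g: "g \<in> carrier G"
  note c = matrix_rep_carrier[OF \<sigma> g] matrix_rep_carrier[OF \<tau> g]
  show "?P * dsum_rep \<sigma> \<tau> g = dsum_rep \<tau> \<sigma> g * ?P"
    using c by (simp add: dsum_rep_eq[OF \<sigma> \<tau> g] dsum_rep_eq[OF \<tau> \<sigma> g]
      mult_four_block_mat[of _ e d _ e _ d _ _ d _ e] mult_four_block_mat[of _ e e _ d _ d _ _ d _ e])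
qed

lemma matrix_rep_list:
  assumes "\<And>i. i \<in> set L \<Longrightarrow> representation G (\<rho> i)"
  shows "matrix_rep G (\<Sum>i\<leftarrow>L. rep_dim G (\<rho> i)) (list_rep \<rho> L)"
  using assms
proof (induction L)
  case Nil
  have "0\<^sub>m 0 0 = (1\<^sub>m 0 :: complex mat)" by (intro eq_matI) auto
  then show ?case by (auto simp: list_rep_def intro!: matrix_repI)
next
  case (Cons i L)
  then have "matrix_rep G (rep_dim G (\<rho> i)) (\<rho> i)" by (simp add: matrix_rep_def)
  then show ?case using matrix_rep_dsum Cons by (simp add: list_rep_Cons)
qed

lemma character_list:
  assumes "\<And>i. i \<in> set L \<Longrightarrow> representation G (\<rho> i)" "g \<in> carrier G"
  shows "character (list_rep \<rho> L) g = (\<Sum>i\<leftarrow>L. character (\<rho> i) g)"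
  using assms
proof (induction L)
  case Nil
  then show ?case by (simp add: list_rep_def character_def)
next
  case (Cons i L)
  then have "matrix_rep G (rep_dim G (\<rho> i)) (\<rho> i)" by (simp add: matrix_rep_def)
  moreover have "matrix_rep G (\<Sum>i\<leftarrow>L. rep_dim G (\<rho> i)) (list_rep \<rho> L)"
    using Cons by (intro matrix_rep_list) auto
  ultimately show ?case using Cons by (simp add: list_rep_Cons character_dsum)
qed

lemma rep_iso_list_perm:
  assumes "mset L = mset L'" "\<And>i. i \<in> set L \<Longrightarrow> representation G (\<rho> i)"
  shows "rep_iso G (list_rep \<rho> L) (list_rep \<rho> L')"
  using assms
proof (induction L arbitrary: L')
  case Nil
  then show ?case using rep_iso_refl[OF matrix_rep_list[of "[]"]] by simp
next
  case (Cons x L)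
  let ?d = "\<lambda>L. \<Sum>i\<leftarrow>L. rep_dim G (\<rho> i)"
  have "x \<in> set L'" using Cons.prems(1) by (metis list.set_intros(1) mset_eq_setD)
  then obtain A B where L': "L' = A @ x # B" by (meson split_list)
  have m: "mset L = mset (A @ B)" using Cons.prems(1) L' by simp
  have sL: "set L = set (A @ B)" using m by (metis mset_eq_setD)
  have rep: "matrix_rep G (?d K) (list_rep \<rho> K)" if "set K \<subseteq> insert x (set L)" for K
    using that Cons.prems(2) by (intro matrix_rep_list) auto
  have dim: "?d L = ?d (A @ B)"
    unfolding sum_mset_sum_list[symmetric] mset_map m ..
  have "rep_iso G (list_rep \<rho> ([x] @ L)) (list_rep \<rho> ([x] @ (A @ B)))"
    unfolding list_rep_append[of _ "[x]"]
    by (rule rep_iso_dsum_cong[of _ _ _ _ "?d [x]" "?d L"])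
       (use Cons m sL rep[of "[x]"] rep[of L] rep[of "A @ B"] dim rep_iso_refl in auto)
  moreover have "rep_iso G (list_rep \<rho> (([x] @ A) @ B)) (list_rep \<rho> ((A @ [x]) @ B))"
    unfolding list_rep_append[of _ _ B]
  proof (rule rep_iso_dsum_cong[of _ _ _ _ "?d ([x] @ A)" "?d B"])
    show "rep_iso G (list_rep \<rho> ([x] @ A)) (list_rep \<rho> (A @ [x]))"
      unfolding list_rep_append using rep[of "[x]"] rep[of A] sL by (intro rep_iso_dsum_comm) auto
  qed (use rep[of "[x] @ A"] rep[of "A @ [x]"] rep[of B] rep_iso_refl sL in \<open>auto simp: add.commute\<close>)
  moreover have "?d (x # A @ B) = ?d (x # L)" "?d L' = ?d (x # L)" using dim L' by simp_all
  then have "matrix_rep G (?d (x # L)) (list_rep \<rho> (x # A @ B))" "matrix_rep G (?d (x # L)) (list_rep \<rho> L')"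
    using rep[of "x # A @ B"] rep[of L'] sL L' by (simp_all del: list.map sum_list.Cons)
  ultimately show ?case
    using rep_iso_trans[OF _ _ rep[of "x # L"]] L' by simp
qed

section \<open>Complete reducibility\<close>

text \<open>
  Comparing the blocks of \<open>\<tau> (g \<otimes> h) = \<tau> g * \<tau> h\<close> shows that the diagonal blocks are representations and
  that \<open>X\<close> is a cocycle, \<open>X (g \<otimes> h) = \<sigma>1 g * X h + X g * \<sigma>2 h\<close>. A unipotent change of basis with upper
  block \<open>Y\<close> removes \<open>X\<close> exactly when \<open>X g = \<sigma>1 g * Y - Y * \<sigma>2 g\<close>, that is, when \<open>X\<close> is a coboundary; over a
  finite group the average of \<open>X h * \<sigma>2 (h\<^sup>-\<^sup>1)\<close> provides such a \<open>Y\<close>, up to sign.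
\<close>
lemma block_triangular_splits:
  assumes \<tau>: "matrix_rep G (r + k) \<tau>"
    and c: "\<And>g. g \<in> carrier G \<Longrightarrow> \<sigma>1 g \<in> carrier_mat r r" "\<And>g. g \<in> carrier G \<Longrightarrow> X g \<in> carrier_mat r k"
      "\<And>g. g \<in> carrier G \<Longrightarrow> \<sigma>2 g \<in> carrier_mat k k"
    and blk: "\<And>g. g \<in> carrier G \<Longrightarrow> \<tau> g = four_block_mat (\<sigma>1 g) (X g) (0\<^sub>m k r) (\<sigma>2 g)"
  shows "matrix_rep G r \<sigma>1" "matrix_rep G k \<sigma>2" "rep_iso G \<tau> (dsum_rep \<sigma>1 \<sigma>2)"
proof -
  have mult: "\<sigma>1 (g \<otimes> h) = \<sigma>1 g * \<sigma>1 h" "X (g \<otimes> h) = \<sigma>1 g * X h + X g * \<sigma>2 h" "\<sigma>2 (g \<otimes> h) = \<sigma>2 g * \<sigma>2 h"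
    if g: "g \<in> carrier G" and h: "h \<in> carrier G" for g h
  proof -
    have gh: "g \<otimes> h \<in> carrier G" using g h by simp
    have "\<tau> (g \<otimes> h) = \<tau> g * \<tau> h" by (rule matrix_rep_mult[OF \<tau> g h])
    then have "four_block_mat (\<sigma>1 (g \<otimes> h)) (X (g \<otimes> h)) (0\<^sub>m k r) (\<sigma>2 (g \<otimes> h)) =
      four_block_mat (\<sigma>1 g * \<sigma>1 h) (\<sigma>1 g * X h + X g * \<sigma>2 h) (0\<^sub>m k r) (\<sigma>2 g * \<sigma>2 h)"
      using c(1)[OF g] c(2)[OF g] c(3)[OF g] c(1)[OF h] c(2)[OF h] c(3)[OF h]
      by (simp add: blk g h gh mult_four_block_mat[of _ r r _ k _ k _ _ r _ k])
    note inj = four_block_mat_inject[OF this c(1)[OF gh] c(2)[OF gh] zero_carrier_mat c(3)[OF gh]]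
    show "\<sigma>1 (g \<otimes> h) = \<sigma>1 g * \<sigma>1 h" "X (g \<otimes> h) = \<sigma>1 g * X h + X g * \<sigma>2 h" "\<sigma>2 (g \<otimes> h) = \<sigma>2 g * \<sigma>2 h"
      using inj c(1)[OF g] c(2)[OF g] c(3)[OF g] c(1)[OF h] c(2)[OF h] c(3)[OF h] by auto
  qed
  have "four_block_mat (\<sigma>1 \<one>) (X \<one>) (0\<^sub>m k r) (\<sigma>2 \<one>) =
      four_block_mat (1\<^sub>m r) (0\<^sub>m r k) (0\<^sub>m k r) (1\<^sub>m k)"
    using matrix_rep_one[OF \<tau>] blk by simp
  note inj = four_block_mat_inject[OF this c(1)[OF one_closed] c(2)[OF one_closed] zero_carrier_mat c(3)[OF one_closed]]
  show \<sigma>1: "matrix_rep G r \<sigma>1" using inj c mult by (intro matrix_repI) auto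
  show \<sigma>2: "matrix_rep G k \<sigma>2" using inj c mult by (intro matrix_repI) auto
  define N where "N = (of_nat (card (carrier G)) :: complex)"
  have N: "N \<noteq> 0" using fin one_closed by (auto simp: N_def)
  define F where "F = (\<lambda>h. X h * \<sigma>2 (inv h))"
  define Z where "Z = group_sum r k F"
  have F: "F g \<in> carrier_mat r k" if "g \<in> carrier G" for g
    using that c(2)[of g] c(3)[of "inv g"] by (simp add: F_def)
  have Z: "Z \<in> carrier_mat r k" by (simp add: Z_def)
  \<comment> \<open>The sum \<open>Z\<close> satisfies the coboundary equation up to the factor \<open>N\<close>: translating its index by \<open>g\<close> and
     applying the cocycle identity produces one copy of \<open>X g\<close> for each element of the group.\<close>
  have key: "Z * \<sigma>2 g = \<sigma>1 g * Z + N \<cdot>\<^sub>m X g" if g: "g \<in> carrier G" for g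
  proof -
    have "Z * \<sigma>2 g = group_sum r k (\<lambda>h. F h * \<sigma>2 g)"
      unfolding Z_def by (rule group_sum_mult[OF c(3)[OF g] F])
    also have "\<dots> = group_sum r k (\<lambda>h. F (g \<otimes> h) * \<sigma>2 g)"
      by (rule group_sum_translate[OF g, symmetric])
    also have "\<dots> = group_sum r k (\<lambda>h. \<sigma>1 g * F h + X g)"
    proof (rule group_sum_cong)
      fix h assume h: "h \<in> carrier G"
      have gh: "g \<otimes> h \<in> carrier G" using g h by simp
      have i: "inv h = inv (g \<otimes> h) \<otimes> g" using g h by (simp add: inv_mult_group m_assoc)
      have "\<sigma>2 (inv h) = \<sigma>2 (inv (g \<otimes> h)) * \<sigma>2 g" by (subst i) (use g gh mult(3) in auto)
      then have "F (g \<otimes> h) * \<sigma>2 g = X (g \<otimes> h) * \<sigma>2 (inv h)"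
        using c(2)[OF gh] c(3)[OF g] c(3)[of "inv (g \<otimes> h)"] gh
        by (simp add: F_def assoc_mult_mat[of _ r k _ k _ k])
      also have "\<dots> = (\<sigma>1 g * X h + X g * \<sigma>2 h) * \<sigma>2 (inv h)" using mult(2)[OF g h] by simp
      also have "\<dots> = \<sigma>1 g * X h * \<sigma>2 (inv h) + X g * \<sigma>2 h * \<sigma>2 (inv h)"
        using c(1)[OF g] c(2)[OF g] c(2)[OF h] c(3)[OF h] c(3)[of "inv h"] h
        by (intro add_mult_distrib_mat[of _ r k]) auto
      also have "X g * \<sigma>2 h * \<sigma>2 (inv h) = X g * (\<sigma>2 h * \<sigma>2 (inv h))"
        using c(2)[OF g] c(3)[OF h] c(3)[of "inv h"] h by (intro assoc_mult_mat) auto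
      also have "\<sigma>2 h * \<sigma>2 (inv h) = 1\<^sub>m k" by (rule matrix_rep_inv(1)[OF \<sigma>2 h])
      also have "X g * 1\<^sub>m k = X g" using c(2)[OF g] by simp
      also have "\<sigma>1 g * X h * \<sigma>2 (inv h) = \<sigma>1 g * F h"
        unfolding F_def using c(1)[OF g] c(2)[OF h] c(3)[of "inv h"] h by (intro assoc_mult_mat) auto
      finally show "F (g \<otimes> h) * \<sigma>2 g = \<sigma>1 g * F h + X g" .
    qed
    also have "\<dots> = group_sum r k (\<lambda>h. \<sigma>1 g * F h) + group_sum r k (\<lambda>h. X g)"
      by (rule group_sum_add) (use c(1)[OF g] F c(2)[OF g] in auto)
    also have "\<dots> = \<sigma>1 g * Z + N \<cdot>\<^sub>m X g"
      unfolding Z_def N_def using mult_group_sum[OF c(1)[OF g] F] group_sum_const[OF c(2)[OF g]] by simp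
    finally show ?thesis .
  qed
  define Y where "Y = (- 1 / N) \<cdot>\<^sub>m Z"
  have Y: "Y \<in> carrier_mat r k" using Z by (simp add: Y_def)
  let ?P = "four_block_mat (1\<^sub>m r) Y (0\<^sub>m k r) (1\<^sub>m k)"
  let ?Q = "four_block_mat (1\<^sub>m r) (- Y) (0\<^sub>m k r) (1\<^sub>m k)"
  show "rep_iso G \<tau> (dsum_rep \<sigma>1 \<sigma>2)"
  proof (rule rep_isoI[OF \<tau> matrix_rep_dsum[OF \<sigma>1 \<sigma>2], of ?P ?Q])
    have "Y + - Y = 0\<^sub>m r k" "- Y + Y = 0\<^sub>m r k" using Y by auto
    moreover have "- (0\<^sub>m k k) = (0\<^sub>m k k :: complex mat)" by (intro eq_matI) auto
    ultimately show "?P * ?Q = 1\<^sub>m (r + k)" "?Q * ?P = 1\<^sub>m (r + k)"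
      using Y by (simp_all add: mult_four_block_mat[of _ r r _ k _ k _ _ r _ k])
    fix g assume g: "g \<in> carrier G"
    have YX: "X g + Y * \<sigma>2 g = \<sigma>1 g * Y"
    proof (rule eq_matI)
      fix i j assume "i < dim_row (\<sigma>1 g * Y)" "j < dim_col (\<sigma>1 g * Y)"
      then have ij: "i < r" "j < k" using c(1)[OF g] Y by auto
      have "(Z * \<sigma>2 g) $$ (i, j) = (\<sigma>1 g * Z) $$ (i, j) + N * X g $$ (i, j)"
        unfolding key[OF g] using ij c(1)[OF g] c(2)[OF g] Z by (simp del: index_mult_mat(1))
      moreover have "(Y * \<sigma>2 g) $$ (i, j) = (- 1 / N) * (Z * \<sigma>2 g) $$ (i, j)"
        unfolding Y_def mult_smult_assoc_mat[OF Z c(3)[OF g]] using ij c(3)[OF g] Z by (simp del: index_mult_mat(1))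
      moreover have "(\<sigma>1 g * Y) $$ (i, j) = (- 1 / N) * (\<sigma>1 g * Z) $$ (i, j)"
        unfolding Y_def mult_smult_distrib[OF c(1)[OF g] Z] using ij c(1)[OF g] Z by (simp del: index_mult_mat(1))
      moreover have "(X g + Y * \<sigma>2 g) $$ (i, j) = X g $$ (i, j) + (Y * \<sigma>2 g) $$ (i, j)"
        using ij c(3)[OF g] Y by (simp del: index_mult_mat(1))
      ultimately show "(X g + Y * \<sigma>2 g) $$ (i, j) = (\<sigma>1 g * Y) $$ (i, j)"
        using N by (simp add: ring_distribs)
    qed (use c(1)[OF g] c(2)[OF g] c(3)[OF g] Y in auto)
    show "?P * \<tau> g = dsum_rep \<sigma>1 \<sigma>2 g * ?P"
      using c(1)[OF g] c(2)[OF g] c(3)[OF g] Y YX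
      by (simp add: blk[OF g] dsum_rep_eq[OF \<sigma>1 \<sigma>2 g] mult_four_block_mat[of _ r r _ k _ k _ _ r _ k])
  qed (use Y in auto)
qed

text \<open>
  In a basis adapted to a proper nonzero invariant subspace the matrices become block triangular.
\<close>
lemma reducible_splits:
  assumes \<tau>: "matrix_rep G d \<tau>" and d: "d > 0" and red: "\<not> irreducible_rep G \<tau>"
  shows "\<exists>r k \<sigma>1 \<sigma>2. r < d \<and> k < d \<and> r + k = d \<and> matrix_rep G r \<sigma>1 \<and> matrix_rep G k \<sigma>2 \<and>
    rep_iso G \<tau> (dsum_rep \<sigma>1 \<sigma>2)"
proof -
  obtain W where W: "vec_closed d W" "\<And>g w. g \<in> carrier G \<Longrightarrow> w \<in> W \<Longrightarrow> \<tau> g *\<^sub>v w \<in> W"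
    "W \<noteq> {0\<^sub>v d}" "W \<noteq> carrier_vec d"
    using red irreducible_rep_iff[OF \<tau>] d by auto
  obtain r P Q where r: "r \<le> d" and P: "P \<in> carrier_mat d d" "Q \<in> carrier_mat d d"
    "P * Q = 1\<^sub>m d" "Q * P = 1\<^sub>m d"
    and WP: "W = (\<lambda>v. P *\<^sub>v v) ` {v \<in> carrier_vec d. \<forall>i. r \<le> i \<longrightarrow> i < d \<longrightarrow> v $ i = 0}"
    using adapted_basis[OF W(1)] by blast
  define k where "k = d - r"
  have rk: "r + k = d" using r by (simp add: k_def)
  have "r \<noteq> 0"
  proof
    assume "r = 0"
    then have "{v \<in> carrier_vec d. \<forall>i. r \<le> i \<longrightarrow> i < d \<longrightarrow> v $ i = 0} = {0\<^sub>v d :: complex vec}"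
      by (auto intro!: eq_vecI)
    then have "W = {P *\<^sub>v 0\<^sub>v d}" using WP by simp
    moreover have "P *\<^sub>v 0\<^sub>v d = 0\<^sub>v d" using P(1) by (auto intro!: eq_vecI)
    ultimately show False using W(3) by simp
  qed
  moreover have "r \<noteq> d"
  proof
    assume "r = d"
    then have WP': "W = (\<lambda>v. P *\<^sub>v v) ` carrier_vec d" using WP by auto
    have "w \<in> W" if w: "w \<in> carrier_vec d" for w
    proof -
      have "P *\<^sub>v (Q *\<^sub>v w) = w" using P w by (simp flip: assoc_mult_mat_vec[of P d d Q d w])
      then show ?thesis unfolding WP' using w P(2) by (intro image_eqI[of _ _ "Q *\<^sub>v w"]) auto
    qed
    then show False using W(1,4) by (auto simp: vec_closed_def)
  qed
  ultimately have lt: "r < d" "k < d" using r d by (auto simp: k_def)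
  define \<tau>' where "\<tau>' = (\<lambda>g. Q * \<tau> g * P)"
  have c': "\<tau>' g \<in> carrier_mat d d" if "g \<in> carrier G" for g
    using matrix_rep_carrier[OF \<tau> that] P by (auto simp: \<tau>'_def)
  have \<tau>': "matrix_rep G d \<tau>'"
  proof (rule matrix_repI)
    fix g h assume g: "g \<in> carrier G" and h: "h \<in> carrier G"
    note cs = matrix_rep_carrier[OF \<tau> g] matrix_rep_carrier[OF \<tau> h]
    have "\<tau>' g * \<tau>' h = Q * \<tau> g * (P * Q) * \<tau> h * P"
      using cs P(1,2) by (simp add: \<tau>'_def assoc_mult_mat[of _ d d _ d _ d] mult_carrier_mat[of _ d d _ d])
    also have "\<dots> = \<tau>' (g \<otimes> h)"
      using cs P by (simp add: \<tau>'_def matrix_rep_mult[OF \<tau> g h] assoc_mult_mat[of _ d d _ d _ d] mult_carrier_mat[of _ d d _ d])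
    finally show "\<tau>' (g \<otimes> h) = \<tau>' g * \<tau>' h" by simp
  qed (use c' P matrix_rep_one[OF \<tau>] in \<open>auto simp: \<tau>'_def\<close>)
  have iso: "rep_iso G \<tau> \<tau>'"
  proof (rule rep_isoI[OF \<tau> \<tau>' P(2,1,4,3)])
    fix g assume g: "g \<in> carrier G"
    note cs = matrix_rep_carrier[OF \<tau> g]
    have "\<tau>' g * Q = Q * \<tau> g * (P * Q)"
      using cs P(1,2) by (simp add: \<tau>'_def assoc_mult_mat[of _ d d _ d _ d] mult_carrier_mat[of _ d d _ d])
    then show "Q * \<tau> g = \<tau>' g * Q" using cs P by simp
  qed
  \<comment> \<open>Column \<open>j\<close> for \<open>j < r\<close> is the image of a basis vector of \<open>W\<close>, in adapted coordinates.\<close>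
  have low: "\<tau>' g $$ (i, j) = 0" if g: "g \<in> carrier G" and i: "r \<le> i" "i < d" and j: "j < r" for g i j
  proof -
    note cs = matrix_rep_carrier[OF \<tau> g]
    have jd: "j < d" using j r by simp
    let ?u = "unit_vec d j :: complex vec"
    have "P *\<^sub>v ?u \<in> W" unfolding WP using j jd by (intro imageI) auto
    then have "\<tau> g *\<^sub>v (P *\<^sub>v ?u) \<in> W" by (rule W(2)[OF g])
    then obtain v where v: "v \<in> carrier_vec d" "\<forall>i. r \<le> i \<longrightarrow> i < d \<longrightarrow> v $ i = 0"
      "\<tau> g *\<^sub>v (P *\<^sub>v ?u) = P *\<^sub>v v" using WP by auto
    have "\<tau>' g *\<^sub>v ?u = Q *\<^sub>v (\<tau> g *\<^sub>v (P *\<^sub>v ?u))"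
      using cs P by (simp add: \<tau>'_def assoc_mult_mat_vec[of _ d d _ d] mult_mat_vec_carrier[of _ d d] mult_carrier_mat[of _ d d _ d])
    also have "\<dots> = v" using v P by (simp flip: assoc_mult_mat_vec[of Q d d P d v])
    finally have "col (\<tau>' g) j = v" using mult_mat_unit_vec[OF c'[OF g] jd] by simp
    then have "col (\<tau>' g) j $ i = 0" using v(2) i by simp
    then show ?thesis using c'[OF g] i jd by simp
  qed
  define \<sigma>1 where "\<sigma>1 = (\<lambda>g. mat r r (\<lambda>(i, j). \<tau>' g $$ (i, j)))"
  define X where "X = (\<lambda>g. mat r k (\<lambda>(i, j). \<tau>' g $$ (i, j + r)))"
  define \<sigma>2 where "\<sigma>2 = (\<lambda>g. mat k k (\<lambda>(i, j). \<tau>' g $$ (i + r, j + r)))"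
  have cc: "\<sigma>1 g \<in> carrier_mat r r" "X g \<in> carrier_mat r k" "\<sigma>2 g \<in> carrier_mat k k" for g
    by (auto simp: \<sigma>1_def \<sigma>2_def X_def)
  have blk: "\<tau>' g = four_block_mat (\<sigma>1 g) (X g) (0\<^sub>m k r) (\<sigma>2 g)" if g: "g \<in> carrier G" for g
    using c'[OF g] low[OF g] rk by (intro eq_matI) (auto simp: \<sigma>1_def \<sigma>2_def X_def)
  note sp = block_triangular_splits[OF \<tau>'[folded rk] cc blk]
  have "rep_iso G \<tau> (dsum_rep \<sigma>1 \<sigma>2)"
    using rep_iso_trans[OF iso sp(3) \<tau> \<tau>'] matrix_rep_dsum[OF sp(1,2)] rk by simp
  then show ?thesis using lt rk sp(1,2) by blast
qed

lemma complete_irrepsD: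
  assumes "complete_irreps G s \<rho>" "i \<le> s"
  shows "irreducible_rep G (\<rho> i)" "representation G (\<rho> i)" "rep_dim G (\<rho> i) > 0"
    "matrix_rep G (rep_dim G (\<rho> i)) (\<rho> i)"
  using assms by (auto simp: complete_irreps_def irreducible_rep_def matrix_rep_def)

lemma rep_iso_matrix_rep_dim: "rep_iso G \<sigma> \<tau> \<Longrightarrow> matrix_rep G d \<sigma> \<Longrightarrow> matrix_rep G e \<tau> \<Longrightarrow> d = e"
  by (auto simp: rep_iso_def matrix_rep_def)

lemma complete_reducibility_list:
  assumes \<rho>: "complete_irreps G s \<rho>" and \<tau>: "matrix_rep G d \<tau>"
  shows "\<exists>L. set L \<subseteq> {..s} \<and> rep_iso G \<tau> (list_rep \<rho> L)"
  using \<tau>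
proof (induction d arbitrary: \<tau> rule: less_induct)
  case (less d)
  show ?case
  proof (cases "d = 0")
    case True
    have m: "matrix_rep G 0 (list_rep \<rho> [])" using matrix_rep_list[of "[]" \<rho>] by simp
    have "rep_iso G \<tau> (list_rep \<rho> [])"
    proof (rule rep_isoI[of 0 _ _ "1\<^sub>m 0" "1\<^sub>m 0"])
      fix g assume g: "g \<in> carrier G"
      show "1\<^sub>m 0 * \<tau> g = list_rep \<rho> [] g * 1\<^sub>m 0"
        using matrix_rep_carrier[OF m g] matrix_rep_carrier[OF less.prems g] True by (intro eq_matI) auto
    qed (use m less.prems True in auto)
    then show ?thesis by (intro exI[of _ "[]"]) auto
  next
    case False
    show ?thesis
    proof (cases "irreducible_rep G \<tau>")
      case True
      then obtain i where "i \<le> s" "rep_iso G \<tau> (\<rho> i)" using \<rho> by (auto simp: complete_irreps_def)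
      then show ?thesis by (intro exI[of _ "[i]"]) (auto simp: list_rep_single)
    next
      case red: False
      obtain r k \<sigma>1 \<sigma>2 where rk: "r < d" "k < d" "r + k = d" "matrix_rep G r \<sigma>1" "matrix_rep G k \<sigma>2"
        "rep_iso G \<tau> (dsum_rep \<sigma>1 \<sigma>2)" using reducible_splits[OF less.prems _ red] False by auto
      obtain L1 where L1: "set L1 \<subseteq> {..s}" "rep_iso G \<sigma>1 (list_rep \<rho> L1)" using less.IH[OF rk(1,4)] by auto
      obtain L2 where L2: "set L2 \<subseteq> {..s}" "rep_iso G \<sigma>2 (list_rep \<rho> L2)" using less.IH[OF rk(2,5)] by auto
      have ex: "\<exists>e. matrix_rep G e (list_rep \<rho> L)" if "set L \<subseteq> {..s}" for L
        using matrix_rep_list[of L \<rho>] complete_irrepsD[OF \<rho>] that by blast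
      have m1: "matrix_rep G r (list_rep \<rho> L1)" using ex[OF L1(1)] rep_iso_matrix_rep_dim[OF L1(2) rk(4)] by auto
      have m2: "matrix_rep G k (list_rep \<rho> L2)" using ex[OF L2(1)] rep_iso_matrix_rep_dim[OF L2(2) rk(5)] by auto
      have "rep_iso G (dsum_rep \<sigma>1 \<sigma>2) (list_rep \<rho> (L1 @ L2))"
        unfolding list_rep_append by (rule rep_iso_dsum_cong[OF L1(2) L2(2) rk(4) m1 rk(5) m2])
      then have "rep_iso G \<tau> (list_rep \<rho> (L1 @ L2))"
        using rep_iso_trans[OF rk(6) _ less.prems] matrix_rep_dsum[OF rk(4,5)] matrix_rep_dsum[OF m1 m2] rk(3)
        by (auto simp: list_rep_append)
      then show ?thesis using L1(1) L2(1) by (intro exI[of _ "L1 @ L2"]) auto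
    qed
  qed
qed

text \<open>
  The irreducible summands come in arbitrary order and are sorted by their index, which gives the direct sum
  with multiplicities.
\<close>
lemma complete_reducibility:
  assumes \<rho>: "complete_irreps G s \<rho>" and \<tau>: "matrix_rep G d \<tau>"
  shows "\<exists>m. rep_iso G \<tau> (sum_rep s m \<rho>)"
proof -
  obtain L where L: "set L \<subseteq> {..s}" "rep_iso G \<tau> (list_rep \<rho> L)"
    using complete_reducibility_list[OF assms] by blast
  \<comment> \<open>The list \<open>?L'\<close> is the sorted form of \<open>L\<close>.\<close>
  let ?L' = "concat (map (\<lambda>j. replicate (count (mset L) j) j) [0..<Suc s])"
  have "count (mset ?L') i = count (mset L) i" for i
  proof -
    have "count (mset ?L') i = (\<Sum>j\<leftarrow>[0..<Suc s]. if j = i then count (mset L) j else 0)"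
      by (rule count_mset_concat_replicate)
    also have "\<dots> = (\<Sum>j\<in>{0..<Suc s}. if j = i then count (mset L) j else 0)"
      by (metis sum_set_upt_conv_sum_list_nat atLeastLessThan_upt)
    also have "\<dots> = count (mset L) i"
      using L(1) by (auto simp: not_in_iff[symmetric] simp flip: set_mset_mset simp del: set_mset_mset)
    finally show ?thesis .
  qed
  then have m: "mset L = mset ?L'" by (intro multiset_eqI) simp
  have rep: "representation G (\<rho> i)" if "i \<in> set L" for i
    using complete_irrepsD[OF \<rho>] that L(1) by auto
  have iso: "rep_iso G (list_rep \<rho> L) (list_rep \<rho> ?L')" by (rule rep_iso_list_perm[OF m rep])
  have mL: "matrix_rep G d (list_rep \<rho> L)"
    using matrix_rep_list[of L \<rho>, OF rep] rep_iso_matrix_rep_dim[OF L(2) \<tau>] by auto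
  have "set ?L' = set L" by (rule mset_eq_setD[OF m, symmetric])
  then have mL': "matrix_rep G d (list_rep \<rho> ?L')"
    using matrix_rep_list[of ?L' \<rho>, OF rep] rep_iso_matrix_rep_dim[OF iso mL] by simp
  show ?thesis
    unfolding sum_rep_eq_list_rep using rep_iso_trans[OF L(2) iso \<tau> mL mL'] by blast
qed

end

section \<open>Tensor products and duals\<close>

lemma kronecker_carrier:
  "A \<in> carrier_mat a b \<Longrightarrow> B \<in> carrier_mat c e \<Longrightarrow> kronecker A B \<in> carrier_mat (a * c) (b * e)"
  by (auto simp: kronecker_def)

text \<open>
  Division with remainder by \<open>b\<close>, the index convention of the Kronecker product.
\<close>
lemma sum_lessThan_mult:
  fixes f :: "nat \<Rightarrow> 'a :: comm_monoid_add"
  shows "(\<Sum>k<a * b. f k) = (\<Sum>i<a. \<Sum>j<b. f (i * b + j))"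
proof -
  have "(\<Sum>k<a * b. f k) = (\<Sum>i<a. sum f {i * b..<i * b + b})"
    by (rule sum.nat_group[symmetric])
  also have "\<dots> = (\<Sum>i<a. \<Sum>j<b. f (i * b + j))"
  proof (rule sum.cong)
    fix i
    show "sum f {i * b..<i * b + b} = (\<Sum>j<b. f (i * b + j))"
      using sum.shift_bounds_nat_ivl[of f 0 "i * b" b]
      by (simp add: lessThan_atLeast0 add.commute)
  qed simp
  finally show ?thesis .
qed

lemma kronecker_mult:
  assumes A: "A \<in> carrier_mat a b" "A' \<in> carrier_mat b c" and B: "B \<in> carrier_mat p q" "B' \<in> carrier_mat q r"
  shows "kronecker A B * kronecker A' B' = kronecker (A * A') (B * B')"
proof (rule eq_matI)
  fix i j assume "i < dim_row (kronecker (A * A') (B * B'))" "j < dim_col (kronecker (A * A') (B * B'))"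
  then have ij: "i < a * p" "j < c * r" using A B by (auto simp: kronecker_def)
  have d: "i div p < a" "i mod p < p" "j div r < c" "j mod r < r"
    using ij by (metis less_mult_imp_div_less mod_less_divisor mult_0_right not_gr_zero not_less0)+
  have "(kronecker A B * kronecker A' B') $$ (i, j) =
      (\<Sum>k<b * q. kronecker A B $$ (i, k) * kronecker A' B' $$ (k, j))"
    using A B ij by (simp add: kronecker_def scalar_prod_def lessThan_atLeast0)
  also have "\<dots> = (\<Sum>k<b * q. (A $$ (i div p, k div q) * B $$ (i mod p, k mod q)) *
       (A' $$ (k div q, j div r) * B' $$ (k mod q, j mod r)))"
    using A B ij by (intro sum.cong) (auto simp: kronecker_def)
  also have "\<dots> = (\<Sum>k<b. \<Sum>l<q. (A $$ (i div p, k) * B $$ (i mod p, l)) *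
       (A' $$ (k, j div r) * B' $$ (l, j mod r)))"
    by (subst sum_lessThan_mult) (auto intro!: sum.cong)
  also have "\<dots> = (\<Sum>k<b. A $$ (i div p, k) * A' $$ (k, j div r)) * (\<Sum>l<q. B $$ (i mod p, l) * B' $$ (l, j mod r))"
    by (simp add: sum_product mult_ac)
  also have "\<dots> = (A * A') $$ (i div p, j div r) * (B * B') $$ (i mod p, j mod r)"
    using A B d by (simp add: scalar_prod_def lessThan_atLeast0)
  also have "\<dots> = kronecker (A * A') (B * B') $$ (i, j)"
    using A B ij by (simp add: kronecker_def)
  finally show "(kronecker A B * kronecker A' B') $$ (i, j) = kronecker (A * A') (B * B') $$ (i, j)" .
qed (use assms in \<open>auto simp: kronecker_def\<close>)

lemma kronecker_one: "kronecker (1\<^sub>m a) (1\<^sub>m b) = 1\<^sub>m (a * b)"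
proof (rule eq_matI)
  fix i j assume "i < dim_row (1\<^sub>m (a * b) :: complex mat)" "j < dim_col (1\<^sub>m (a * b) :: complex mat)"
  then have ij: "i < a * b" "j < a * b" by auto
  have d: "i div b < a" "i mod b < b" "j div b < a" "j mod b < b"
    using ij by (metis less_mult_imp_div_less mod_less_divisor mult_0_right not_gr_zero not_less0)+
  have "i = j \<longleftrightarrow> i div b = j div b \<and> i mod b = j mod b" by (metis div_mult_mod_eq)
  then show "kronecker (1\<^sub>m a) (1\<^sub>m b) $$ (i, j) = (1\<^sub>m (a * b) :: complex mat) $$ (i, j)"
    using ij d by (auto simp: kronecker_def)
qed (auto simp: kronecker_def)

lemma trace_kronecker:
  assumes "A \<in> carrier_mat a a" "B \<in> carrier_mat b b"
  shows "trace_mat (kronecker A B) = trace_mat A * trace_mat B"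
proof -
  have "trace_mat (kronecker A B) = (\<Sum>k<a * b. A $$ (k div b, k div b) * B $$ (k mod b, k mod b))"
    using assms by (auto simp: trace_mat_def kronecker_def)
  also have "\<dots> = (\<Sum>i<a. \<Sum>j<b. A $$ (i, i) * B $$ (j, j))"
    by (subst sum_lessThan_mult) (auto intro!: sum.cong)
  also have "\<dots> = trace_mat A * trace_mat B"
    using assms by (simp add: trace_mat_def sum_product)
  finally show ?thesis .
qed

definition dual_rep :: "('g, 'b) monoid_scheme \<Rightarrow> ('g \<Rightarrow> complex mat) \<Rightarrow> 'g \<Rightarrow> complex mat" where
  "dual_rep G \<sigma> g = transpose_mat (\<sigma> (inv\<^bsub>G\<^esub> g))"

context fin_group
begin

lemma matrix_rep_tensor:
  assumes \<sigma>: "matrix_rep G d \<sigma>" and \<tau>: "matrix_rep G e \<tau>"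
  shows "matrix_rep G (d * e) (tensor_rep \<sigma> \<tau>)"
proof (rule matrix_repI)
  fix g h assume g: "g \<in> carrier G" and h: "h \<in> carrier G"
  note c = matrix_rep_carrier[OF \<sigma> g] matrix_rep_carrier[OF \<tau> g] matrix_rep_carrier[OF \<sigma> h] matrix_rep_carrier[OF \<tau> h]
  show "tensor_rep \<sigma> \<tau> (g \<otimes> h) = tensor_rep \<sigma> \<tau> g * tensor_rep \<sigma> \<tau> h"
    using kronecker_mult[OF c(1,3,2,4)]
    by (simp add: tensor_rep_def matrix_rep_mult[OF \<sigma> g h] matrix_rep_mult[OF \<tau> g h])
qed (use matrix_rep_carrier[OF \<sigma>] matrix_rep_carrier[OF \<tau>] in
      \<open>auto simp: tensor_rep_def kronecker_carrier kronecker_one matrix_rep_one[OF \<sigma>] matrix_rep_one[OF \<tau>]\<close>)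

lemma character_tensor:
  assumes "matrix_rep G d \<sigma>" "matrix_rep G e \<tau>" "g \<in> carrier G"
  shows "character (tensor_rep \<sigma> \<tau>) g = character \<sigma> g * character \<tau> g"
  using trace_kronecker[OF matrix_rep_carrier[OF assms(1,3)] matrix_rep_carrier[OF assms(2,3)]]
  by (simp add: character_eq_trace tensor_rep_def)

lemma matrix_rep_dual:
  assumes \<sigma>: "matrix_rep G d \<sigma>"
  shows "matrix_rep G d (dual_rep G \<sigma>)"
proof (rule matrix_repI)
  fix g h assume g: "g \<in> carrier G" and h: "h \<in> carrier G"
  note c = matrix_rep_carrier[OF \<sigma> inv_closed[OF g]] matrix_rep_carrier[OF \<sigma> inv_closed[OF h]]
  show "dual_rep G \<sigma> (g \<otimes> h) = dual_rep G \<sigma> g * dual_rep G \<sigma> h"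
    using g h transpose_mult[OF c(2,1)] by (simp add: dual_rep_def inv_mult_group matrix_rep_mult[OF \<sigma>])
qed (use matrix_rep_carrier[OF \<sigma>] in \<open>auto simp: dual_rep_def matrix_rep_one[OF \<sigma>]\<close>)

lemma character_dual:
  assumes "matrix_rep G d \<sigma>" "g \<in> carrier G"
  shows "character (dual_rep G \<sigma>) g = character \<sigma> (inv g)"
  using matrix_rep_carrier[OF assms(1) inv_closed[OF assms(2)]]
  by (simp add: character_def dual_rep_def)

end

section \<open>Multiplicities as pairings of characters\<close>

lemma sum_list_concat_replicate:
  fixes f :: "'b \<Rightarrow> 'a :: semiring_1"
  shows "(\<Sum>i\<leftarrow>concat (map (\<lambda>j. replicate (m j) j) K). f i) = (\<Sum>j\<leftarrow>K. of_nat (m j) * f j)"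
  by (induction K) (auto simp: sum_list_replicate)

context fin_group
begin

lemma character_sum:
  assumes \<rho>: "complete_irreps G s \<rho>" and g: "g \<in> carrier G"
  shows "character (sum_rep s m \<rho>) g = (\<Sum>j\<le>s. of_nat (m j) * character (\<rho> j) g)"
proof -
  have "character (sum_rep s m \<rho>) g = (\<Sum>i\<leftarrow>concat (map (\<lambda>j. replicate (m j) j) [0..<Suc s]). character (\<rho> i) g)"
    unfolding sum_rep_eq_list_rep
    using complete_irrepsD(2)[OF \<rho>] g by (intro character_list) (auto simp del: upt_Suc)
  also have "\<dots> = (\<Sum>j\<leftarrow>[0..<Suc s]. of_nat (m j) * character (\<rho> j) g)"
    by (rule sum_list_concat_replicate)
  also have "\<dots> = (\<Sum>j\<le>s. of_nat (m j) * character (\<rho> j) g)"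
    by (simp only: interv_sum_list_conv_sum_set_nat atLeastLessThanSuc_atLeastAtMost atLeast0AtMost set_upt)
  finally show ?thesis .
qed

lemma matrix_rep_sum:
  assumes \<rho>: "complete_irreps G s \<rho>"
  shows "\<exists>d. matrix_rep G d (sum_rep s m \<rho>)"
  unfolding sum_rep_eq_list_rep
  by (rule exI, rule matrix_rep_list) (use complete_irrepsD(2)[OF \<rho>] in \<open>auto simp del: upt_Suc\<close>)

lemma character_of_decomposition:
  assumes \<rho>: "complete_irreps G s \<rho>" and \<tau>: "matrix_rep G d \<tau>" and iso: "rep_iso G \<tau> (sum_rep s m \<rho>)"
    and g: "g \<in> carrier G"
  shows "character \<tau> g = (\<Sum>j\<le>s. of_nat (m j) * character (\<rho> j) g)"
proof -
  have "matrix_rep G d (sum_rep s m \<rho>)"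
    using matrix_rep_sum[OF \<rho>] rep_iso_matrix_rep_dim[OF iso \<tau>] by blast
  then show ?thesis using character_rep_iso[OF iso \<tau> _ g] character_sum[OF \<rho> g] by simp
qed

lemma char_pairing_irreps:
  assumes \<rho>: "complete_irreps G s \<rho>" and "i \<le> s" "j \<le> s"
  shows "char_pairing (character (\<rho> i)) (character (\<rho> j)) = (if i = j then of_nat (card (carrier G)) else 0)"
proof (cases "i = j")
  case True
  then show ?thesis using char_pairing_self complete_irrepsD[OF \<rho> assms(2)] by simp
next
  case False
  then have "\<not> rep_iso G (\<rho> j) (\<rho> i)" using \<rho> assms(2,3) unfolding complete_irreps_def by blast
  then show ?thesis
    using False char_pairing_non_iso complete_irrepsD[OF \<rho> assms(2)] complete_irrepsD[OF \<rho> assms(3)] by simp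
qed

lemma char_pairing_decomposition:
  assumes \<rho>: "complete_irreps G s \<rho>" and \<tau>: "matrix_rep G d \<tau>" and iso: "rep_iso G \<tau> (sum_rep s m \<rho>)"
    and j: "j \<le> s"
  shows "char_pairing (character \<tau>) (character (\<rho> j)) = of_nat (card (carrier G) * m j)"
proof -
  have "char_pairing (character \<tau>) (character (\<rho> j))
     = (\<Sum>g\<in>carrier G. \<Sum>i\<le>s. of_nat (m i) * (character (\<rho> i) g * character (\<rho> j) (inv g)))"
    unfolding char_pairing_def
    by (intro sum.cong refl) (simp add: character_of_decomposition[OF \<rho> \<tau> iso] sum_distrib_right mult.assoc)
  also have "\<dots> = (\<Sum>i\<le>s. of_nat (m i) * char_pairing (character (\<rho> i)) (character (\<rho> j)))"
    unfolding char_pairing_def sum_distrib_left by (rule sum.swap)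
  also have "\<dots> = (\<Sum>i\<le>s. if i = j then of_nat (card (carrier G) * m j) else 0)"
    by (intro sum.cong) (auto simp: char_pairing_irreps[OF \<rho> _ j])
  also have "\<dots> = of_nat (card (carrier G) * m j)" using j by simp
  finally show ?thesis .
qed

lemma card_pos: "card (carrier G) > 0"
  using fin one_closed by (auto simp: card_gt_0_iff)

text \<open>
  The pairing of the character of \<open>\<tau>\<close> with an irreducible one determines the multiplicity in any decomposition,
  which makes the definite description meaningful.
\<close>
lemma multiplicity_in_eq:
  assumes \<rho>: "complete_irreps G s \<rho>" and \<tau>: "matrix_rep G d \<tau>" and iso: "rep_iso G \<tau> (sum_rep s m \<rho>)"
    and j: "j \<le> s"
  shows "multiplicity_in G s \<rho> j \<tau> = m j"
  unfolding multiplicity_in_def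
proof (rule the_equality)
  show "\<exists>m'. rep_iso G \<tau> (sum_rep s m' \<rho>) \<and> m' j = m j" using iso by blast
  fix k assume "\<exists>m'. rep_iso G \<tau> (sum_rep s m' \<rho>) \<and> m' j = k"
  then obtain m' where m': "rep_iso G \<tau> (sum_rep s m' \<rho>)" "m' j = k" by blast
  have "(of_nat (card (carrier G) * m' j) :: complex) = of_nat (card (carrier G) * m j)"
    using char_pairing_decomposition[OF \<rho> \<tau> m'(1) j] char_pairing_decomposition[OF \<rho> \<tau> iso j] by metis
  then show "k = m j" using card_pos m'(2) by (simp only: of_nat_eq_iff mult_cancel1) auto
qed

lemma char_pairing_multiplicity:
  assumes \<rho>: "complete_irreps G s \<rho>" and \<tau>: "matrix_rep G d \<tau>" and j: "j \<le> s"
  shows "char_pairing (character \<tau>) (character (\<rho> j)) = of_nat (card (carrier G) * multiplicity_in G s \<rho> j \<tau>)"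
proof -
  obtain m where "rep_iso G \<tau> (sum_rep s m \<rho>)" using complete_reducibility[OF \<rho> \<tau>] by blast
  then show ?thesis
    using char_pairing_decomposition[OF \<rho> \<tau> _ j] multiplicity_in_eq[OF \<rho> \<tau> _ j] by simp
qed

lemma character_at_one: "matrix_rep G d \<sigma> \<Longrightarrow> character \<sigma> \<one> = of_nat d"
  using character_one[OF is_group] by (simp add: matrix_rep_def)

text \<open>
  The decomposition of characters is evaluated at the neutral element.
\<close>
lemma dim_eq_sum_multiplicity:
  assumes \<rho>: "complete_irreps G s \<rho>" and \<tau>: "matrix_rep G d \<tau>"
  shows "(\<Sum>j\<le>s. multiplicity_in G s \<rho> j \<tau> * rep_dim G (\<rho> j)) = d"
proof -
  obtain m where iso: "rep_iso G \<tau> (sum_rep s m \<rho>)" using complete_reducibility[OF \<rho> \<tau>] by blast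
  have "(of_nat d :: complex) = (\<Sum>j\<le>s. of_nat (m j) * character (\<rho> j) \<one>)"
    using character_of_decomposition[OF \<rho> \<tau> iso one_closed] character_at_one[OF \<tau>] by simp
  also have "\<dots> = of_nat (\<Sum>j\<le>s. m j * rep_dim G (\<rho> j))"
    using character_at_one[OF complete_irrepsD(4)[OF \<rho>]] by simp
  finally have "d = (\<Sum>j\<le>s. m j * rep_dim G (\<rho> j))" by (simp only: of_nat_eq_iff)
  then show ?thesis using multiplicity_in_eq[OF \<rho> \<tau> iso] by simp
qed

text \<open>
  Both multiplicities are pairings of characters, and the substitution of \<open>g\<^sup>-\<^sup>1\<close> for \<open>g\<close> carries one sum to
  the other.
\<close>
lemma multiplicity_dual:
  assumes \<rho>: "complete_irreps G s \<rho>" and \<pi>: "matrix_rep G n \<pi>" and i: "i \<le> s" and j: "j \<le> s"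
  shows "multiplicity_in G s \<rho> j (tensor_rep \<pi> (\<rho> i)) = multiplicity_in G s \<rho> i (tensor_rep (dual_rep G \<pi>) (\<rho> j))"
proof -
  note \<rho>i = complete_irrepsD(4)[OF \<rho> i] and \<rho>j = complete_irrepsD(4)[OF \<rho> j]
  note \<pi>' = matrix_rep_dual[OF \<pi>]
  have "char_pairing (character (tensor_rep \<pi> (\<rho> i))) (character (\<rho> j))
      = (\<Sum>g\<in>carrier G. character \<pi> g * character (\<rho> i) g * character (\<rho> j) (inv g))"
    unfolding char_pairing_def by (simp add: character_tensor[OF \<pi> \<rho>i])
  also have "\<dots> = (\<Sum>g\<in>carrier G. character \<pi> (inv g) * character (\<rho> i) (inv g) * character (\<rho> j) g)"
    by (intro sum.reindex_bij_witness[of _ "\<lambda>g. inv g" "\<lambda>g. inv g"]) auto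
  also have "\<dots> = char_pairing (character (tensor_rep (dual_rep G \<pi>) (\<rho> j))) (character (\<rho> i))"
    unfolding char_pairing_def by (simp add: character_tensor[OF \<pi>' \<rho>j] character_dual[OF \<pi>] mult_ac)
  finally have "(of_nat (card (carrier G) * multiplicity_in G s \<rho> j (tensor_rep \<pi> (\<rho> i))) :: complex) =
     of_nat (card (carrier G) * multiplicity_in G s \<rho> i (tensor_rep (dual_rep G \<pi>) (\<rho> j)))"
    using char_pairing_multiplicity[OF \<rho> matrix_rep_tensor[OF \<pi> \<rho>i] j]
      char_pairing_multiplicity[OF \<rho> matrix_rep_tensor[OF \<pi>' \<rho>j] i] by simp
  then show ?thesis using card_pos by (simp only: of_nat_eq_iff mult_cancel1) auto
qed

end

section \<open>The generalized Cartan matrix\<close>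

text \<open>
  Expanding the squares, the terms with \<open>(x i)\<^sup>2\<close> collect the row sums of \<open>m i j * d j\<close> and those with
  \<open>(x j)\<^sup>2\<close> the column sums of \<open>m i j * d i\<close>; the weights \<open>d i * d j\<close> are chosen so that both become
  multiples of \<open>n\<close>.
\<close>
lemma weighted_laplacian_identity:
  fixes m :: "nat \<Rightarrow> nat \<Rightarrow> real"
  assumes d: "\<And>i. i \<le> s \<Longrightarrow> d i > 0"
    and row: "\<And>i. i \<le> s \<Longrightarrow> (\<Sum>j\<le>s. m i j * d j) = n * d i"
    and col: "\<And>j. j \<le> s \<Longrightarrow> (\<Sum>i\<le>s. m i j * d i) = n * d j"
  shows "2 * (n * (\<Sum>i\<le>s. (x i)\<^sup>2) - (\<Sum>i\<le>s. \<Sum>j\<le>s. m i j * x i * x j)) =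
    (\<Sum>i\<le>s. \<Sum>j\<le>s. m i j * d i * d j * (x i / d i - x j / d j)\<^sup>2)"
proof -
  have "(\<Sum>i\<le>s. \<Sum>j\<le>s. m i j * d i * d j * (x i / d i - x j / d j)\<^sup>2) =
     (\<Sum>i\<le>s. \<Sum>j\<le>s. (m i j * d j) * ((x i)\<^sup>2 / d i) + (m i j * d i) * ((x j)\<^sup>2 / d j) - 2 * (m i j * x i * x j))"
  proof (intro sum.cong refl)
    fix i j assume "i \<in> {..s}" "j \<in> {..s}"
    then have "d i \<noteq> 0" "d j \<noteq> 0" using d by force+
    then show "m i j * d i * d j * (x i / d i - x j / d j)\<^sup>2 =
      (m i j * d j) * ((x i)\<^sup>2 / d i) + (m i j * d i) * ((x j)\<^sup>2 / d j) - 2 * (m i j * x i * x j)"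
      by (simp add: field_simps power2_eq_square)
  qed
  also have "\<dots> = (\<Sum>i\<le>s. \<Sum>j\<le>s. (m i j * d j) * ((x i)\<^sup>2 / d i)) + (\<Sum>i\<le>s. \<Sum>j\<le>s. (m i j * d i) * ((x j)\<^sup>2 / d j))
      - 2 * (\<Sum>i\<le>s. \<Sum>j\<le>s. m i j * x i * x j)"
    by (simp add: sum.distrib sum_subtractf sum_distrib_left)
  also have "(\<Sum>i\<le>s. \<Sum>j\<le>s. (m i j * d j) * ((x i)\<^sup>2 / d i)) = (\<Sum>i\<le>s. n * d i * ((x i)\<^sup>2 / d i))"
    by (simp only: sum_distrib_right[symmetric]) (simp add: row)
  also have "(\<Sum>i\<le>s. \<Sum>j\<le>s. (m i j * d i) * ((x j)\<^sup>2 / d j)) = (\<Sum>j\<le>s. n * d j * ((x j)\<^sup>2 / d j))"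
    by (subst sum.swap, simp only: sum_distrib_right[symmetric]) (simp add: col)
  also have "(\<Sum>i\<le>s. n * d i * ((x i)\<^sup>2 / d i)) = n * (\<Sum>i\<le>s. (x i)\<^sup>2)"
    unfolding sum_distrib_left using d by (intro sum.cong) force+
  finally show ?thesis by simp
qed

context fin_group
begin

text \<open>
  For a representation of degree \<open>n\<close> of any finite group, the eigenvector relations for rows and columns of
  the multiplicity matrix cancel the diagonal of \<open>A\<close> on the dimension vector and turn its quadratic form into a
  sum of squares.
\<close>
lemma generalized_Cartan_semidefinite:
  assumes \<rho>: "complete_irreps G s \<rho>" and \<pi>: "matrix_rep G n \<pi>"
  shows "pos_semidef (generalized_Cartan G \<pi> s \<rho>)"
    and "eigenvector (generalized_Cartan G \<pi> s \<rho>) (dim_vector G s \<rho>) 0"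
proof -
  define m where "m = (\<lambda>i j. real (multiplicity_in G s \<rho> j (tensor_rep \<pi> (\<rho> i))))"
  define d where "d = (\<lambda>i. real (rep_dim G (\<rho> i)))"
  define A where "A = generalized_Cartan G \<pi> s \<rho>"
  have n: "rep_dim G \<pi> = n" using \<pi> by (simp add: matrix_rep_def)
  have d_pos: "d i > 0" if "i \<le> s" for i using complete_irrepsD(3)[OF \<rho> that] by (simp add: d_def)
  have row: "(\<Sum>j\<le>s. m i j * d j) = n * d i" if i: "i \<le> s" for i
    unfolding m_def d_def of_nat_mult[symmetric] of_nat_sum[symmetric]
    by (simp only: dim_eq_sum_multiplicity[OF \<rho> matrix_rep_tensor[OF \<pi> complete_irrepsD(4)[OF \<rho> i]]])
  have col: "(\<Sum>i\<le>s. m i j * d i) = n * d j" if j: "j \<le> s" for j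
  proof -
    have "(\<Sum>i\<le>s. m i j * d i) =
        (\<Sum>i\<le>s. real (multiplicity_in G s \<rho> i (tensor_rep (dual_rep G \<pi>) (\<rho> j))) * d i)"
      by (intro sum.cong) (simp_all add: m_def multiplicity_dual[OF \<rho> \<pi> _ j])
    also have "\<dots> = n * d j"
      unfolding d_def of_nat_mult[symmetric] of_nat_sum[symmetric]
      by (simp only: dim_eq_sum_multiplicity[OF \<rho>
            matrix_rep_tensor[OF matrix_rep_dual[OF \<pi>] complete_irrepsD(4)[OF \<rho> j]]])
    finally show ?thesis .
  qed
  have A: "A \<in> carrier_mat (Suc s) (Suc s)" by (simp add: A_def generalized_Cartan_def pre_Cartan_def)
  have ent: "A $$ (i, j) = (if i = j then 2 * real n else 0) - m i j - m j i" if "i \<le> s" "j \<le> s" for i j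
    using that by (auto simp: A_def generalized_Cartan_def pre_Cartan_def m_def n)
  have Ax: "(A *\<^sub>v x) $ i = 2 * real n * x $ i - (\<Sum>j\<le>s. m i j * x $ j) - (\<Sum>j\<le>s. m j i * x $ j)"
    if x: "x \<in> carrier_vec (Suc s)" and i: "i \<le> s" for x i
  proof -
    have "(A *\<^sub>v x) $ i = (\<Sum>j\<le>s. A $$ (i, j) * x $ j)"
      using A x i by (simp add: scalar_prod_def atLeast0LessThan lessThan_Suc_atMost)
    also have "\<dots> = (\<Sum>j\<le>s. (if j = i then 2 * real n * x $ i else 0) - m i j * x $ j - m j i * x $ j)"
      using i by (intro sum.cong) (auto simp: ent algebra_simps)
    also have "\<dots> = 2 * real n * x $ i - (\<Sum>j\<le>s. m i j * x $ j) - (\<Sum>j\<le>s. m j i * x $ j)"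
      using i by (simp add: sum_subtractf)
    finally show ?thesis .
  qed
  have sym: "transpose_mat A = A"
    using A by (intro eq_matI) (auto simp: ent)
  have "x \<bullet> (A *\<^sub>v x) \<ge> 0" if x: "x \<in> carrier_vec (Suc s)" for x
  proof -
    have "x \<bullet> (A *\<^sub>v x) = (\<Sum>i\<le>s. x $ i * (A *\<^sub>v x) $ i)"
      using A x by (simp add: scalar_prod_def atLeast0LessThan lessThan_Suc_atMost)
    also have "\<dots> = (\<Sum>i\<le>s. 2 * real n * (x $ i)\<^sup>2 - (\<Sum>j\<le>s. m i j * x $ i * x $ j) - (\<Sum>j\<le>s. m j i * x $ j * x $ i))"
      by (intro sum.cong refl)
        (simp add: Ax[OF x] right_diff_distrib sum_distrib_left power2_eq_square mult_ac)
    also have "\<dots> = 2 * real n * (\<Sum>i\<le>s. (x $ i)\<^sup>2) - (\<Sum>i\<le>s. \<Sum>j\<le>s. m i j * x $ i * x $ j)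
        - (\<Sum>i\<le>s. \<Sum>j\<le>s. m j i * x $ j * x $ i)"
      by (simp add: sum_subtractf sum_distrib_left)
    also have "(\<Sum>i\<le>s. \<Sum>j\<le>s. m j i * x $ j * x $ i) = (\<Sum>i\<le>s. \<Sum>j\<le>s. m i j * x $ i * x $ j)"
      by (rule sum.swap)
    also have "2 * real n * (\<Sum>i\<le>s. (x $ i)\<^sup>2) - (\<Sum>i\<le>s. \<Sum>j\<le>s. m i j * x $ i * x $ j)
        - (\<Sum>i\<le>s. \<Sum>j\<le>s. m i j * x $ i * x $ j)
      = 2 * (real n * (\<Sum>i\<le>s. (x $ i)\<^sup>2) - (\<Sum>i\<le>s. \<Sum>j\<le>s. m i j * x $ i * x $ j))" by simp
    also have "\<dots> = (\<Sum>i\<le>s. \<Sum>j\<le>s. m i j * d i * d j * (x $ i / d i - x $ j / d j)\<^sup>2)"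
      by (rule weighted_laplacian_identity[OF d_pos row col])
    also have "\<dots> \<ge> 0"
      by (intro sum_nonneg mult_nonneg_nonneg) (auto simp: m_def d_def)
    finally show ?thesis .
  qed
  then show "pos_semidef (generalized_Cartan G \<pi> s \<rho>)"
    unfolding A_def[symmetric] pos_semidef_def using A sym by auto
  have \<delta>: "dim_vector G s \<rho> = vec (Suc s) d" by (simp add: dim_vector_def d_def)
  have "A *\<^sub>v vec (Suc s) d = 0 \<cdot>\<^sub>v vec (Suc s) d"
  proof (rule eq_vecI)
    fix i assume "i < dim_vec (0 \<cdot>\<^sub>v vec (Suc s) d)"
    then have i: "i \<le> s" by simp
    have "(A *\<^sub>v vec (Suc s) d) $ i = 2 * real n * d i - (\<Sum>j\<le>s. m i j * d j) - (\<Sum>j\<le>s. m j i * d j)"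
      using Ax[of "vec (Suc s) d" i] i by simp
    then show "(A *\<^sub>v vec (Suc s) d) $ i = (0 \<cdot>\<^sub>v vec (Suc s) d) $ i"
      using i row[OF i] col[OF i] by simp
  qed (use A in auto)
  moreover have "vec (Suc s) d $ 0 \<noteq> 0\<^sub>v (Suc s) $ 0" using d_pos[of 0] by simp
  then have "vec (Suc s) d \<noteq> 0\<^sub>v (Suc s)" by metis
  ultimately show "eigenvector (generalized_Cartan G \<pi> s \<rho>) (dim_vector G s \<rho>) 0"
    unfolding A_def[symmetric] \<delta> eigenvector_def using A by auto
qed

end

theorem theorem2p4:
  fixes n s :: nat
    and G :: "complex mat set"
    and \<rho> :: "nat \<Rightarrow> complex mat \<Rightarrow> complex mat"
  assumes "n \<ge> 1"
    and "subgroup G (SL n)"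
    and "finite G"
    and "G \<noteq> {1\<^sub>m n}"
    and "complete_irreps (subgroup_of_SL n G) s \<rho>"
  shows "pos_semidef (generalized_Cartan (subgroup_of_SL n G) natural_rep s \<rho>) \<and>
         eigenvector (generalized_Cartan (subgroup_of_SL n G) natural_rep s \<rho>)
           (dim_vector (subgroup_of_SL n G) s \<rho>) 0"
proof -
  have "group (subgroup_of_SL n G)"
    unfolding subgroup_of_SL_def by (rule subgroup.subgroup_is_group[OF assms(2) group_SL])
  moreover have "finite (carrier (subgroup_of_SL n G))"
    using assms(3) by (simp add: subgroup_of_SL_def)
  ultimately interpret fin_group "subgroup_of_SL n G"
    by (simp add: fin_group_def fin_group_axioms_def)
  have "matrix_rep (subgroup_of_SL n G) n natural_rep"
    using representation_natural_rep[OF assms(2)] by (simp add: matrix_rep_def)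
  then show ?thesis using generalized_Cartan_semidefinite[OF assms(5)] by blast
qed

end
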